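(* Let $\Gamma$ be a group acting faithfully by homeomorphisms on a Hausdorff space $X$. Suppose that for every non-empty open set $U\subseteq X$, the rigid stabilizer $\mathrm{RStab}_\Gamma(U)$ is non-amenable. Then $\Gamma$ is $\ell^2$-invisible.
   Context: Groups are discrete. The rigid stabilizer of $Y\subseteq X$ is $\mathrm{RStab}_\Gamma(Y)=\{g\in\Gamma\mid g.x=x\text{ for all }x\in X\setminus Y\}$. A group $\Gamma$ is $\ell^2$-invisible if its group homology $H_i(\Gamma;\mathcal N(\Gamma))$ with coefficients in its group von Neumann algebra $\mathcal N(\Gamma)$ vanishes for all degrees $i\ge 0$.
   Formalization: The space X is assumed to be non-empty; for empty X the group is trivial, the condition on rigid stabilizers is vacuous, and the trivial group is not ℓ²-invisible. *)

theory Defs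
  imports
    "HOL-Analysis.Analysis"
    "HOL-Algebra.Group_Action"
    "HOL-Algebra.Elementary_Groups"
    "HOL-Library.Function_Algebras"
    "HOL-Library.Poly_Mapping"
begin

section \<open>Rigid stabilizers and amenability\<close>

definition rigid_stabilizer ::
    "('g, 'b) monoid_scheme \<Rightarrow> 'x set \<Rightarrow> ('g \<Rightarrow> 'x \<Rightarrow> 'x) \<Rightarrow> 'x set \<Rightarrow> 'g set" where
  "rigid_stabilizer G E \<phi> Y = {g \<in> carrier G. \<forall>x \<in> E - Y. \<phi> g x = x}"

text \<open>
  Amenability of a discrete group, in von Neumann's sense: existence of a left-invariant
  finitely additive probability measure defined on all subsets.
\<close>

definition amenable :: "('g, 'b) monoid_scheme \<Rightarrow> bool" where
  "amenable G \<longleftrightarrow> (\<exists>\<mu> :: 'g set \<Rightarrow> real.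
     \<mu> (carrier G) = 1 \<and>
     (\<forall>A \<subseteq> carrier G. 0 \<le> \<mu> A) \<and>
     (\<forall>A \<subseteq> carrier G. \<forall>B \<subseteq> carrier G. A \<inter> B = {} \<longrightarrow> \<mu> (A \<union> B) = \<mu> A + \<mu> B) \<and>
     (\<forall>g \<in> carrier G. \<forall>A \<subseteq> carrier G. \<mu> (g <#\<^bsub>G\<^esub> A) = \<mu> A))"


section \<open>The group von Neumann algebra\<close>

text \<open>
  Elements of the Hilbert space of square-summable functions on the group are represented by
  functions on the ambient type that vanish off the carrier. Operators are represented by functions
  that are zero off the Hilbert space, so that equality of operators is equality of functions and
  addition of operators is pointwise addition.
\<close>

definition l2_space :: "('g, 'b) monoid_scheme \<Rightarrow> ('g \<Rightarrow> complex) set" where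
  "l2_space G = {f. (\<forall>x. x \<notin> carrier G \<longrightarrow> f x = 0) \<and>
                    (\<lambda>x. (cmod (f x))\<^sup>2) summable_on carrier G}"

definition l2_norm :: "('g, 'b) monoid_scheme \<Rightarrow> ('g \<Rightarrow> complex) \<Rightarrow> real" where
  "l2_norm G f = sqrt (\<Sum>\<^sub>\<infinity>x\<in>carrier G. (cmod (f x))\<^sup>2)"

type_synonym 'g operator = "('g \<Rightarrow> complex) \<Rightarrow> ('g \<Rightarrow> complex)"

definition bounded_operators :: "('g, 'b) monoid_scheme \<Rightarrow> 'g operator set" where
  "bounded_operators G = {T.
     (\<forall>f. f \<notin> l2_space G \<longrightarrow> T f = 0) \<and>
     (\<forall>f \<in> l2_space G. T f \<in> l2_space G) \<and>
     (\<forall>f \<in> l2_space G. \<forall>h \<in> l2_space G. T (f + h) = T f + T h) \<and>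
     (\<forall>c. \<forall>f \<in> l2_space G. T (\<lambda>x. c * f x) = (\<lambda>x. c * T f x)) \<and>
     (\<exists>C. \<forall>f \<in> l2_space G. l2_norm G (T f) \<le> C * l2_norm G f)}"

text \<open>
  On point masses, the left regular representation sends \<open>\<delta>\<^sub>h\<close> to \<open>\<delta>\<^sub>g\<^sub>h\<close>, and the right regular
  representation sends \<open>\<delta>\<^sub>h\<close> to the point mass at \<open>h \<otimes> inv g\<close>; both are homomorphisms in \<open>g\<close>.
\<close>

definition left_regular :: "('g, 'b) monoid_scheme \<Rightarrow> 'g \<Rightarrow> 'g operator" where
  "left_regular G g = (\<lambda>f. if f \<in> l2_space G
     then (\<lambda>x. if x \<in> carrier G then f (inv\<^bsub>G\<^esub> g \<otimes>\<^bsub>G\<^esub> x) else 0) else 0)"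

definition right_regular :: "('g, 'b) monoid_scheme \<Rightarrow> 'g \<Rightarrow> 'g operator" where
  "right_regular G g = (\<lambda>f. if f \<in> l2_space G
     then (\<lambda>x. if x \<in> carrier G then f (x \<otimes>\<^bsub>G\<^esub> g) else 0) else 0)"

text \<open>
  The bounded operators that are equivariant for the left regular representation. The group ring
  embeds through the right regular representation.
\<close>

definition group_vN :: "('g, 'b) monoid_scheme \<Rightarrow> 'g operator set" where
  "group_vN G = {T \<in> bounded_operators G.
     \<forall>g \<in> carrier G. T \<circ> left_regular G g = left_regular G g \<circ> T}"

text \<open>Right multiplication by group elements, making the algebra a right module over the group ring.\<close>

definition vN_act :: "('g, 'b) monoid_scheme \<Rightarrow> 'g operator \<Rightarrow> 'g \<Rightarrow> 'g operator" where
  "vN_act G T g = T \<circ> right_regular G g"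


section \<open>Group homology\<close>

text \<open>
  Homology of a group \<open>G\<close> with coefficients in a right module: an additive subgroup \<open>M\<close> of an ambient
  abelian group with a right action \<open>act\<close> of \<open>G\<close> by additive maps. It is computed by the
  inhomogeneous bar complex, whose \<open>n\<close>-chains are the finite sums of terms \<open>m [g\<^sub>1|...|g\<^sub>n]\<close>, with
  \<open>\<partial>(m [g\<^sub>1|...|g\<^sub>n]) = m g\<^sub>1 [g\<^sub>2|...|g\<^sub>n] + (\<Sum>0<i<n. (-1)\<^sup>i m [g\<^sub>1|...|g\<^sub>i g\<^sub>i\<^sub>+\<^sub>1|...|g\<^sub>n])
  + (-1)\<^sup>n m [g\<^sub>1|...|g\<^sub>n\<^sub>-\<^sub>1]\<close>.
\<close>

definition bar_chains ::
    "('g, 'b) monoid_scheme \<Rightarrow> 'm::ab_group_add set \<Rightarrow> nat \<Rightarrow> ('g list \<Rightarrow>\<^sub>0 'm) set" where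
  "bar_chains G M n = {c.
     Poly_Mapping.keys c \<subseteq> {xs. length xs = n \<and> set xs \<subseteq> carrier G} \<and>
     range (Poly_Mapping.lookup c) \<subseteq> M}"

definition bar_face :: "('g, 'b) monoid_scheme \<Rightarrow> nat \<Rightarrow> 'g list \<Rightarrow> 'g list" where
  "bar_face G i xs =
     (if i = 0 then tl xs
      else if i = length xs then butlast xs
      else take (i - 1) xs @ (xs ! (i - 1) \<otimes>\<^bsub>G\<^esub> xs ! i) # drop (i + 1) xs)"

definition bar_boundary_term ::
    "('g, 'b) monoid_scheme \<Rightarrow> ('m::ab_group_add \<Rightarrow> 'g \<Rightarrow> 'm) \<Rightarrow> 'm \<Rightarrow> 'g list \<Rightarrow> ('g list \<Rightarrow>\<^sub>0 'm)" where
  "bar_boundary_term G act m xs =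
     (if xs = [] then 0
      else Poly_Mapping.single (bar_face G 0 xs) (act m (hd xs)) +
           (\<Sum>i = 1..length xs. Poly_Mapping.single (bar_face G i xs) (if even i then m else - m)))"

definition bar_boundary ::
    "('g, 'b) monoid_scheme \<Rightarrow> ('m::ab_group_add \<Rightarrow> 'g \<Rightarrow> 'm) \<Rightarrow> ('g list \<Rightarrow>\<^sub>0 'm) \<Rightarrow> ('g list \<Rightarrow>\<^sub>0 'm)" where
  "bar_boundary G act c =
     (\<Sum>xs \<in> Poly_Mapping.keys c. bar_boundary_term G act (Poly_Mapping.lookup c xs) xs)"

definition bar_cycles ::
    "('g, 'b) monoid_scheme \<Rightarrow> 'm::ab_group_add set \<Rightarrow> ('m \<Rightarrow> 'g \<Rightarrow> 'm) \<Rightarrow> nat \<Rightarrow> ('g list \<Rightarrow>\<^sub>0 'm) set" where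
  "bar_cycles G M act n = {c \<in> bar_chains G M n. bar_boundary G act c = 0}"

definition bar_boundaries ::
    "('g, 'b) monoid_scheme \<Rightarrow> 'm::ab_group_add set \<Rightarrow> ('m \<Rightarrow> 'g \<Rightarrow> 'm) \<Rightarrow> nat \<Rightarrow> ('g list \<Rightarrow>\<^sub>0 'm) set" where
  "bar_boundaries G M act n = bar_boundary G act ` bar_chains G M (Suc n)"

definition group_homology ::
    "('g, 'b) monoid_scheme \<Rightarrow> 'm::ab_group_add set \<Rightarrow> ('m \<Rightarrow> 'g \<Rightarrow> 'm) \<Rightarrow> nat
      \<Rightarrow> ('g list \<Rightarrow>\<^sub>0 'm) set monoid" where
  "group_homology G M act n =
     \<lparr>carrier = bar_cycles G M act n, monoid.mult = (+), one = 0\<rparr> Mod bar_boundaries G M act n"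

definition l2_invisible :: "('g, 'b) monoid_scheme \<Rightarrow> bool" where
  "l2_invisible G \<longleftrightarrow> (\<forall>n. trivial_group (group_homology G (group_vN G) (vN_act G) n))"

end

theory Submission
  imports Defs
begin

text \<open>
  The germs at a base point \<open>x0\<close> of elements of \<open>\<Gamma>\<close> form a \<open>\<Gamma>\<close>-set \<open>S\<close>, and an element of the
  stabilizer of finitely many germs is the identity near finitely many points. As \<open>X\<close> is Hausdorff
  without isolated points, any finite set \<open>F\<close> of such elements fixes pointwise an open set \<open>V\<close> that stays
  away from these points, so that \<open>K = RStab V\<close> centralizes \<open>F\<close> and is contained in the stabilizer.
  Non-amenability of \<open>K\<close> produces \<open>k\<^sub>1, \<dots>, k\<^sub>r\<close> in \<open>K\<close> whose average \<open>P\<close> together with the identity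
  has norm \<open>< 1\<close> on the square-summable functions; a multiple \<open>a\<close> of the inverse of \<open>1 - P\<close> then gives
  \<open>m = (\<Sum>i. m a - m a k\<^sub>i)\<close>, where \<open>a\<close> commutes with \<open>F\<close>. Since a cycle involves only finitely many
  group elements, and since the \<open>k\<^sub>i\<close>, commuting with them, act trivially on homology, all homology of
  these stabilizers with coefficients in the von Neumann algebra vanishes. The simplices on
  \<open>S\<close> form an acyclic complex, so the double complex of \<open>\<Gamma>\<close> and \<open>S\<close> transfers the vanishing to \<open>\<Gamma>\<close>.
\<close>

section \<open>Additive extension of maps on basis elements\<close>

text \<open>Points of \<open>X\<close> would not do in place of germs: an element fixing a point
  need not fix any open set around it pointwise, and then no rigid stabilizer need commute with it.
  The obstacle that shapes the argument is finiteness. The elements k and the operator a are chosen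
  after a finite set F, and \<open>T \<mapsto> T \<circ> a\<close> multiplies on the side on which
  the group acts, so it is only known to be compatible with elements that centralize the k. Hence no
  equivariant contraction of a whole complex is at hand; each cycle is filled separately, and it
  must be known which finitely many identifications of \<open>m g\<close> at a simplex with
  \<open>m\<close> at its g-translate witness that it is a cycle in the coinvariants. Chains are
  therefore kept as concrete formal sums, and equality in the coinvariants is membership in a group
  of relations that records its generators. The spectral gap is taken on functions on the whole
  group, although non-amenability is that of a subgroup, because a has to lie in the von Neumann
  algebra of the whole group.\<close>

definition add_subgroup :: "'a::ab_group_add set \<Rightarrow> bool" where
  "add_subgroup R \<longleftrightarrow> 0 \<in> R \<and> (\<forall>x\<in>R. \<forall>y\<in>R. x - y \<in> R)"

lemma add_subgroup_zero: "add_subgroup R \<Longrightarrow> 0 \<in> R"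
  and add_subgroup_diff: "add_subgroup R \<Longrightarrow> x \<in> R \<Longrightarrow> y \<in> R \<Longrightarrow> x - y \<in> R"
  by (auto simp: add_subgroup_def)

lemma add_subgroup_uminus: "add_subgroup R \<Longrightarrow> x \<in> R \<Longrightarrow> - x \<in> R"
  by (metis add_subgroup_def diff_0)

lemma add_subgroup_add: "add_subgroup R \<Longrightarrow> x \<in> R \<Longrightarrow> y \<in> R \<Longrightarrow> x + y \<in> R"
  by (metis add_subgroup_diff add_subgroup_uminus diff_minus_eq_add)

lemma add_subgroup_sum: "add_subgroup R \<Longrightarrow> (\<And>i. i \<in> I \<Longrightarrow> f i \<in> R) \<Longrightarrow> sum f I \<in> R"
  by (induction I rule: infinite_finite_induct)
     (simp_all add: add_subgroup_zero add_subgroup_add)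

text \<open>The coefficient is an argument of \<open>f\<close> rather than a scalar factor, since
  later maps alter the coefficient by group elements that depend on the simplex.\<close>

definition additive_extension :: "('a \<Rightarrow> 'm::ab_group_add \<Rightarrow> 'c::ab_group_add) \<Rightarrow> ('a \<Rightarrow>\<^sub>0 'm) \<Rightarrow> 'c" where
  "additive_extension f c = (\<Sum>\<sigma>\<in>Poly_Mapping.keys c. f \<sigma> (Poly_Mapping.lookup c \<sigma>))"

lemma additive_single: "Modules.additive (Poly_Mapping.single k)"
  by unfold_locales (rule single_add)

lemma additive_zero: "Modules.additive (\<lambda>x. 0)"
  by (simp add: Modules.additive_def)

lemma additive_id: "Modules.additive (\<lambda>x. x)"
  by (simp add: Modules.additive_def)

lemma additive_comp: "Modules.additive f \<Longrightarrow> Modules.additive g \<Longrightarrow> Modules.additive (\<lambda>x. f (g x))"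
  by (simp add: Modules.additive_def)

lemma additive_extension_additive:
  assumes "\<And>\<sigma>. Modules.additive (f \<sigma>)"
  shows "Modules.additive (additive_extension f)"
proof
  fix c d
  show "additive_extension f (c + d) = additive_extension f c + additive_extension f d"
    unfolding additive_extension_def
    by (rule setsum_keys_plus_distrib) (auto simp: assms additive.zero additive.add)
qed

lemma additive_extension_single:
  assumes "Modules.additive (f \<sigma>)"
  shows "additive_extension f (Poly_Mapping.single \<sigma> m) = f \<sigma> m"
  using assms by (cases "m = 0") (auto simp: additive_extension_def additive.zero)

definition chains :: "'a set \<Rightarrow> 'm::ab_group_add set \<Rightarrow> ('a \<Rightarrow>\<^sub>0 'm) set" where
  "chains X M = {c. Poly_Mapping.keys c \<subseteq> X \<and> range (Poly_Mapping.lookup c) \<subseteq> M}"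

lemma add_subgroup_chains:
  assumes M: "add_subgroup M"
  shows "add_subgroup (chains X M)"
  unfolding add_subgroup_def
proof (intro conjI ballI)
  show "0 \<in> chains X M" using M by (auto simp: chains_def add_subgroup_zero)
  fix c d assume "c \<in> chains X M" "d \<in> chains X M"
  then have *: "Poly_Mapping.keys c \<subseteq> X" "Poly_Mapping.keys d \<subseteq> X"
    "Poly_Mapping.lookup c \<sigma> \<in> M" "Poly_Mapping.lookup d \<sigma> \<in> M" for \<sigma>
    by (auto simp: chains_def)
  then show "c - d \<in> chains X M"
    using keys_diff[of c d] M by (auto simp: chains_def lookup_minus add_subgroup_diff)
qed

lemma single_in_chains:
  "add_subgroup M \<Longrightarrow> \<sigma> \<in> X \<Longrightarrow> m \<in> M \<Longrightarrow> Poly_Mapping.single \<sigma> m \<in> chains X M"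
  by (auto simp: chains_def lookup_single when_def add_subgroup_zero)

lemma poly_mapping_eq_sum_singles:
  "c = (\<Sum>\<sigma>\<in>Poly_Mapping.keys c. Poly_Mapping.single \<sigma> (Poly_Mapping.lookup c \<sigma>))"
  by (rule poly_mapping_eqI)
     (auto simp: lookup_sum lookup_single when_def in_keys_iff if_distrib cong: if_cong)

lemma chains_induct [consumes 1, case_names zero add]:
  assumes "c \<in> chains X M" "P 0"
    and step: "\<And>\<sigma> m d. \<sigma> \<in> X \<Longrightarrow> m \<in> M \<Longrightarrow> P d \<Longrightarrow> P (d + Poly_Mapping.single \<sigma> m)"
  shows "P c"
proof -
  have "P (\<Sum>\<sigma>\<in>K. Poly_Mapping.single \<sigma> (Poly_Mapping.lookup c \<sigma>))"
    if "finite K" "K \<subseteq> Poly_Mapping.keys c" for K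
    using that
  proof (induction K rule: finite_induct)
    case empty
    then show ?case using assms(2) by simp
  next
    case (insert \<sigma> K)
    have "\<sigma> \<in> X" "Poly_Mapping.lookup c \<sigma> \<in> M"
      using insert assms(1) by (auto simp: chains_def)
    from step[OF this insert.IH] insert show ?case by (simp add: add.commute)
  qed
  from this[of "Poly_Mapping.keys c"] show ?thesis
    by (simp flip: poly_mapping_eq_sum_singles)
qed

lemma additive_closed_on_chains:
  assumes "Modules.additive f" "add_subgroup R" "c \<in> chains X M"
    and "\<And>\<sigma> m. \<sigma> \<in> X \<Longrightarrow> m \<in> M \<Longrightarrow> f (Poly_Mapping.single \<sigma> m) \<in> R"
  shows "f c \<in> R"
  using assms(3)
proof (induction rule: chains_induct)
  case zero
  then show ?case using assms(1,2) by (simp add: additive.zero add_subgroup_zero)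
next
  case (add \<sigma> m d)
  then show ?case using assms by (simp add: additive.add add_subgroup_add)
qed

lemma additive_extension_closed:
  assumes "\<And>\<sigma>. Modules.additive (f \<sigma>)" "add_subgroup R" "c \<in> chains X M"
    and "\<And>\<sigma> m. \<sigma> \<in> X \<Longrightarrow> m \<in> M \<Longrightarrow> f \<sigma> m \<in> R"
  shows "additive_extension f c \<in> R"
  by (rule additive_closed_on_chains[OF additive_extension_additive[of f, OF assms(1)] assms(2,3)])
     (simp add: additive_extension_single assms)

lemma additive_eq_on_chains:
  assumes "Modules.additive f" "Modules.additive g" "c \<in> chains X M"
    and "\<And>\<sigma> m. \<sigma> \<in> X \<Longrightarrow> m \<in> M \<Longrightarrow>
           f (Poly_Mapping.single \<sigma> m) = g (Poly_Mapping.single \<sigma> m)"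
  shows "f c = g c"
  using assms(3)
proof (induction rule: chains_induct)
  case zero
  then show ?case using assms(1,2) by (simp add: additive.zero)
next
  case (add \<sigma> m d)
  then show ?case using assms by (simp add: additive.add)
qed

section \<open>Alternating sums over the faces of a simplex\<close>

text \<open>The augmented simplicial boundary and the prism operator are evaluated against an arbitrary
  function \<open>f\<close> on simplices; the recursions then take the place of index manipulations.\<close>

fun alt_faces :: "('a list \<Rightarrow> 'c::ab_group_add) \<Rightarrow> 'a list \<Rightarrow> 'c" where
  "alt_faces f [] = 0"
| "alt_faces f (x # xs) = f xs - alt_faces (\<lambda>ys. f (x # ys)) xs"

fun prism :: "('a list \<Rightarrow> 'c::ab_group_add) \<Rightarrow> ('a \<Rightarrow> 'a) \<Rightarrow> 'a list \<Rightarrow> 'c" where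
  "prism f u [] = 0"
| "prism f u (x # xs) = f (x # u x # map u xs) - prism (\<lambda>ys. f (x # ys)) u xs"

lemma alt_faces_closed:
  assumes "add_subgroup R"
    and "\<And>ys. Suc (length ys) = length xs \<Longrightarrow> set ys \<subseteq> set xs \<Longrightarrow> f ys \<in> R"
  shows "alt_faces f xs \<in> R"
  using assms(2)
proof (induction xs arbitrary: f)
  case Nil
  then show ?case by (simp add: assms(1) add_subgroup_zero)
next
  case (Cons x xs)
  have "alt_faces (\<lambda>ys. f (x # ys)) xs \<in> R"
    by (rule Cons.IH) (rule Cons.prems; auto)
  moreover have "f xs \<in> R" by (rule Cons.prems) auto
  ultimately show ?case by (simp add: assms(1) add_subgroup_diff)
qed

lemma alt_faces_diff: "alt_faces (\<lambda>ys. f ys - g ys) xs = alt_faces f xs - alt_faces g xs"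
  by (induction xs arbitrary: f g) (simp_all add: algebra_simps)

lemma alt_faces_add: "alt_faces (\<lambda>ys. f ys + g ys) xs = alt_faces f xs + alt_faces g xs"
  by (induction xs arbitrary: f g) (simp_all add: algebra_simps)

lemma alt_faces_map: "alt_faces f (map h xs) = alt_faces (\<lambda>ys. f (map h ys)) xs"
  by (induction xs arbitrary: f) simp_all

lemma additive_alt_faces: "Modules.additive h \<Longrightarrow> h (alt_faces f xs) = alt_faces (\<lambda>ys. h (f ys)) xs"
  by (induction xs arbitrary: f) (simp_all add: additive.zero additive.diff)

lemma alt_faces_alt_faces: "alt_faces (alt_faces f) xs = 0"
  by (induction xs arbitrary: f) (simp_all add: alt_faces_diff)

text \<open>Each differential acts on its own list of vertices, so the two commute without a
  sign.\<close>

lemma alt_faces_commute: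
  "alt_faces (\<lambda>xs. alt_faces (f xs) ys) xs = alt_faces (\<lambda>ys. alt_faces (\<lambda>xs. f xs ys) xs) ys"
proof (induction xs arbitrary: f)
  case Nil
  show ?case by (induction ys) simp_all
qed (simp add: alt_faces_diff)

text \<open>The bridge to explicit indices, for comparison with the bar boundary.\<close>

lemma alt_faces_eq_sum:
  "alt_faces f xs =
     (\<Sum>i<length xs. if even i then f (take i xs @ drop (Suc i) xs)
                     else - f (take i xs @ drop (Suc i) xs))"
proof (induction xs arbitrary: f)
  case (Cons x xs)
  show ?case
    by (simp add: Cons.IH sum.lessThan_Suc_shift sum_negf[symmetric] del: sum.lessThan_Suc)
       (rule sum.cong; simp)
qed simp

lemma prism_closed:
  assumes "add_subgroup R"
    and "\<And>ys. length ys = Suc (length xs) \<Longrightarrow> set ys \<subseteq> set xs \<union> u ` set xs \<Longrightarrow> f ys \<in> R"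
  shows "prism f u xs \<in> R"
  using assms(2)
proof (induction xs arbitrary: f)
  case Nil
  then show ?case by (simp add: assms(1) add_subgroup_zero)
next
  case (Cons x xs)
  have "prism (\<lambda>ys. f (x # ys)) u xs \<in> R"
    by (rule Cons.IH) (rule Cons.prems; auto)
  moreover have "f (x # u x # map u xs) \<in> R" by (rule Cons.prems) auto
  ultimately show ?case by (simp add: assms(1) add_subgroup_diff)
qed

lemma prism_diff: "prism (\<lambda>ys. f ys - g ys) u xs = prism f u xs - prism g u xs"
  by (induction xs arbitrary: f g) (simp_all add: algebra_simps)

lemma prism_add: "prism (\<lambda>ys. f ys + g ys) u xs = prism f u xs + prism g u xs"
  by (induction xs arbitrary: f g) (simp_all add: algebra_simps)

text \<open>Two vertex maps are allowed because translating the germ vertices changes the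
  conjugating element used by the prism.\<close>

lemma prism_map:
  assumes "\<And>x. x \<in> set xs \<Longrightarrow> u' (h x) = h (u x)"
  shows "prism f u' (map h xs) = prism (\<lambda>ys. f (map h ys)) u xs"
  using assms
proof (induction xs arbitrary: f)
  case (Cons x xs)
  have "map u' (map h xs) = map h (map u xs)" "u' (h x) = h (u x)"
    using Cons.prems by simp_all
  moreover have "prism (\<lambda>ys. f (h x # ys)) u' (map h xs) = prism (\<lambda>ys. f (h x # map h ys)) u xs"
    by (rule Cons.IH) (rule Cons.prems; simp)
  ultimately show ?case by (simp only: prism.simps list.map)
qed simp

lemma additive_prism: "Modules.additive h \<Longrightarrow> h (prism f u xs) = prism (\<lambda>ys. h (f ys)) u xs"
  by (induction xs arbitrary: f) (simp_all add: additive.zero additive.diff)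

lemma prism_homotopy:
  "prism (alt_faces f) u xs + alt_faces (prism f u) xs = f (map u xs) - f xs"
proof (induction xs arbitrary: f)
  case (Cons x xs)
  \<comment> \<open>The intermediate value \<open>f (x # map u xs)\<close> cancels against the face
    of the leading simplex \<open>x # u x # map u xs\<close> in which \<open>u x\<close> is
    deleted.\<close>
  have "prism (\<lambda>ys. alt_faces (\<lambda>zs. f (x # zs)) ys) u xs
      + alt_faces (prism (\<lambda>zs. f (x # zs)) u) xs = f (x # map u xs) - f (x # xs)"
    by (rule Cons.IH)
  then show ?case
    by (simp add: prism_diff alt_faces_diff alt_faces_map algebra_simps)
qed simp


section \<open>Coinvariants and the double complex\<close>

text \<open>The set \<open>S\<close> plays the role of the germs of group elements at a base point, \<open>s0\<close> is the germ
  of the identity, and \<open>lift_germ\<close> picks a group element with a given germ. Assumption \<open>splitting\<close>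
  expresses that every finite subset of the stabilizer of \<open>s0\<close> is centralized by finitely many
  elements \<open>k\<close> that fix prescribed germs and satisfy \<open>m = (\<Sum>k. A m - act (A m) k)\<close>.\<close>

locale germ_split = group G for G (structure) +
  fixes M :: "'m::ab_group_add set" and act :: "'m \<Rightarrow> 'a \<Rightarrow> 'm"
    and S :: "'s set" and sact :: "'a \<Rightarrow> 's \<Rightarrow> 's" and s0 :: 's and lift_germ :: "'s \<Rightarrow> 'a"
  assumes M: "add_subgroup M"
    and act_additive: "Modules.additive (\<lambda>m. act m g)"
    and act_closed: "m \<in> M \<Longrightarrow> g \<in> carrier G \<Longrightarrow> act m g \<in> M"
    and act_mult: "m \<in> M \<Longrightarrow> g \<in> carrier G \<Longrightarrow> h \<in> carrier G \<Longrightarrow> act m (g \<otimes> h) = act (act m g) h"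
    and act_one: "m \<in> M \<Longrightarrow> act m \<one> = m"
    and s0: "s0 \<in> S"
    and sact_closed: "g \<in> carrier G \<Longrightarrow> s \<in> S \<Longrightarrow> sact g s \<in> S"
    and sact_mult: "g \<in> carrier G \<Longrightarrow> h \<in> carrier G \<Longrightarrow> s \<in> S \<Longrightarrow> sact (g \<otimes> h) s = sact g (sact h s)"
    and sact_one: "s \<in> S \<Longrightarrow> sact \<one> s = s"
    and lift_germ: "s \<in> S \<Longrightarrow> lift_germ s \<in> carrier G" "s \<in> S \<Longrightarrow> sact (lift_germ s) s0 = s"
    and splitting: "finite F \<Longrightarrow> F \<subseteq> {g \<in> carrier G. sact g s0 = s0} \<Longrightarrow> finite Q \<Longrightarrow> Q \<subseteq> S \<Longrightarrow>
      \<exists>A K. Modules.additive A \<and> A ` M \<subseteq> M \<and> finite K \<and> K \<subseteq> carrier G \<and>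
        (\<forall>f\<in>F. \<forall>m\<in>M. A (act m f) = act (A m) f) \<and>
        (\<forall>f\<in>F. \<forall>k\<in>K. f \<otimes> k = k \<otimes> f) \<and> (\<forall>k\<in>K. \<forall>s\<in>Q. sact k s = s) \<and>
        (\<forall>m\<in>M. m = (\<Sum>k\<in>K. A m - act (A m) k))"
begin

section \<open>Chains with diagonal action and the relations of the coinvariants\<close>

fun pact :: "'a \<Rightarrow> 'a list \<times> 's list \<Rightarrow> 'a list \<times> 's list" where
  "pact g (hs, ts) = (map ((\<otimes>) g) hs, map (sact g) ts)"

definition prods :: "('a list \<times> 's list) set" where
  "prods = {(hs, ts). set hs \<subseteq> carrier G \<and> set ts \<subseteq> S}"

text \<open>The indices count vertices, so they exceed the simplicial dimensions by one; the value 0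
  is the augmentation term in either direction.\<close>

definition Ch :: "nat \<Rightarrow> nat \<Rightarrow> ('a list \<times> 's list \<Rightarrow>\<^sub>0 'm) set" where
  "Ch q p = chains {(hs, ts) \<in> prods. length hs = q \<and> length ts = p} M"

text \<open>For all pairs in the carrier and \<open>prods\<close>, the quotient by this group is the
  tensor product over the group ring. The parameter \<open>W\<close> restricts which pairs of a
  group element and a simplex may be used.\<close>

inductive_set rel :: "('a \<times> 'a list \<times> 's list) set \<Rightarrow> ('a list \<times> 's list \<Rightarrow>\<^sub>0 'm) set"
  for W where
  zero: "0 \<in> rel W"
| step: "r \<in> rel W \<Longrightarrow> m \<in> M \<Longrightarrow> (g, \<sigma>) \<in> W \<Longrightarrow>
    r + (Poly_Mapping.single \<sigma> (act m g) - Poly_Mapping.single (pact g \<sigma>) m) \<in> rel W"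

abbreviation "R \<equiv> rel (carrier G \<times> prods)"

lemma act_diff: "act (m - n) g = act m g - act n g"
  using additive.diff[OF act_additive] .
lemma act_sum: "act (\<Sum>i\<in>I. f i) g = (\<Sum>i\<in>I. act (f i) g)"
  using additive.sum[OF act_additive] .

lemma rel_generator:
  "m \<in> M \<Longrightarrow> (g, \<sigma>) \<in> W \<Longrightarrow>
    Poly_Mapping.single \<sigma> (act m g) - Poly_Mapping.single (pact g \<sigma>) m \<in> rel W"
  using rel.step[OF rel.zero] by simp

lemma rel_generator':
  "m \<in> M \<Longrightarrow> g \<in> carrier G \<Longrightarrow> set hs \<subseteq> carrier G \<Longrightarrow> set ts \<subseteq> S \<Longrightarrow>
    Poly_Mapping.single (hs, ts) (act m g)
      - Poly_Mapping.single (map ((\<otimes>) g) hs, map (sact g) ts) m \<in> R"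
  using rel_generator[of m g "(hs, ts)" "carrier G \<times> prods"] by (simp add: prods_def)

lemma add_subgroup_rel: "add_subgroup (rel W)"
proof -
  have neg: "- r \<in> rel W" if "r \<in> rel W" for r
    using that
  proof induction
    case (step r m g \<sigma>)
    have "- m \<in> M" using M step add_subgroup_uminus by blast
    from rel.step[OF step.IH this step.hyps(3)] show ?case
      by (simp add: additive.minus[OF act_additive] single_uminus algebra_simps)
  qed (simp add: rel.zero)
  have add: "s + r \<in> rel W" if "s \<in> rel W" "r \<in> rel W" for r s
    using that(2) that(1)
    by induction (auto simp: add.assoc[symmetric] intro: rel.step)
  show ?thesis
    unfolding add_subgroup_def using rel.zero add neg by (metis diff_conv_add_uminus)
qed

lemma rel_mono:
  assumes "W \<subseteq> W'" shows "rel W \<subseteq> rel W'"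
proof
  fix r assume "r \<in> rel W" then show "r \<in> rel W'"
    by induction (use assms in \<open>auto intro: rel.intros\<close>)
qed

text \<open>Equivariance then has to be arranged for finitely many pairs only, which is all that
  \<open>splitting\<close> provides.\<close>

lemma rel_finite_support:
  "r \<in> rel W \<Longrightarrow> \<exists>W'. finite W' \<and> W' \<subseteq> W \<and> r \<in> rel W'"
proof (induction rule: rel.induct)
  case zero
  show ?case by (auto intro: rel.zero)
next
  case (step r m g \<sigma>)
  then obtain W' where W': "finite W'" "W' \<subseteq> W" "r \<in> rel W'" by blast
  have "r \<in> rel (insert (g, \<sigma>) W')" using rel_mono W' by blast
  from rel.step[OF this step.hyps(2)] W' step.hyps show ?case
    by (intro exI[of _ "insert (g, \<sigma>) W'"]) auto
qed

lemma additive_extension_rel: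
  assumes f: "\<And>\<sigma>. Modules.additive (f \<sigma>)" and T: "add_subgroup T" and r: "r \<in> rel W"
    and gen: "\<And>m g \<sigma>. m \<in> M \<Longrightarrow> (g, \<sigma>) \<in> W \<Longrightarrow> f \<sigma> (act m g) - f (pact g \<sigma>) m \<in> T"
  shows "additive_extension f r \<in> T"
  using r
proof induction
  case zero
  show ?case using T by (simp add: additive_extension_def add_subgroup_zero)
next
  case (step r m g \<sigma>)
  note add = additive_extension_additive[of f, OF f]
  show ?case
    using step gen[OF step.hyps(2,3)]
    by (simp add: additive.add[OF add] additive.diff[OF add] additive_extension_single f
        add_subgroup_add T)
qed

section \<open>Boundary, cone, prism and translation operators\<close>

fun dG_term :: "'a list \<times> 's list \<Rightarrow> 'm \<Rightarrow> ('a list \<times> 's list \<Rightarrow>\<^sub>0 'm)" where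
  "dG_term (hs, ts) m = alt_faces (\<lambda>ys. Poly_Mapping.single (ys, ts) m) hs"
fun dS_term :: "'a list \<times> 's list \<Rightarrow> 'm \<Rightarrow> ('a list \<times> 's list \<Rightarrow>\<^sub>0 'm)" where
  "dS_term (hs, ts) m = alt_faces (\<lambda>ys. Poly_Mapping.single (hs, ys) m) ts"
text \<open>Without a group vertex there is no equivariant choice of an apex; the value 0 is a
  default, and the contraction identity is stated for chains with a group vertex.\<close>

fun cone_term :: "'a list \<times> 's list \<Rightarrow> 'm \<Rightarrow> ('a list \<times> 's list \<Rightarrow>\<^sub>0 'm)" where
  "cone_term (hs, ts) m = (if hs = [] then 0 else Poly_Mapping.single (hs, sact (hd hs) s0 # ts) m)"
text \<open>The map \<open>A\<close> is transported from the base germ to the germ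
  \<open>hd ts\<close>. Lifts are unique only up to the stabilizer of \<open>s0\<close>, so
  equivariance holds as far as \<open>A\<close> commutes with the stabilizer elements that
  occur.\<close>

fun split_term :: "('m \<Rightarrow> 'm) \<Rightarrow> 'a list \<times> 's list \<Rightarrow> 'm \<Rightarrow> ('a list \<times> 's list \<Rightarrow>\<^sub>0 'm)" where
  "split_term A (hs, ts) m = (if ts = [] then 0 else Poly_Mapping.single (hs, ts)
     (act (A (act m (lift_germ (hd ts)))) (inv (lift_germ (hd ts)))))"

definition conj_lift :: "'a \<Rightarrow> 's list \<Rightarrow> 'a" where
  "conj_lift k ts = lift_germ (hd ts) \<otimes> k \<otimes> inv (lift_germ (hd ts))"

fun prism_term :: "'a \<Rightarrow> 'a list \<times> 's list \<Rightarrow> 'm \<Rightarrow> ('a list \<times> 's list \<Rightarrow>\<^sub>0 'm)" where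
  "prism_term k (hs, ts) m = prism (\<lambda>ys. Poly_Mapping.single (ys, ts) m) ((\<otimes>) (conj_lift k ts)) hs"
fun shift_term :: "'a \<Rightarrow> 'a list \<times> 's list \<Rightarrow> 'm \<Rightarrow> ('a list \<times> 's list \<Rightarrow>\<^sub>0 'm)" where
  "shift_term k (hs, ts) m = Poly_Mapping.single (map ((\<otimes>) (conj_lift k ts)) hs, ts) m"
fun coeff_term :: "'a \<Rightarrow> 'a list \<times> 's list \<Rightarrow> 'm \<Rightarrow> ('a list \<times> 's list \<Rightarrow>\<^sub>0 'm)" where
  "coeff_term k (hs, ts) m = Poly_Mapping.single (hs, ts) (act m (conj_lift k ts))"

abbreviation "dG \<equiv> additive_extension dG_term"
abbreviation "dS \<equiv> additive_extension dS_term"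
abbreviation "germ_cone \<equiv> additive_extension cone_term"

lemma
  shows additive_dG_term: "Modules.additive (dG_term \<sigma>)"
    and additive_dS_term: "Modules.additive (dS_term \<sigma>)"
    and additive_cone_term: "Modules.additive (cone_term \<sigma>)"
    and additive_split_term: "Modules.additive A \<Longrightarrow> Modules.additive (split_term A \<sigma>)"
    and additive_prism_term: "Modules.additive (prism_term k \<sigma>)"
    and additive_shift_term: "Modules.additive (shift_term k \<sigma>)"
    and additive_coeff_term: "Modules.additive (coeff_term k \<sigma>)"
  by (cases \<sigma>; simp add: Modules.additive_def single_add alt_faces_add prism_add
      additive.add[OF act_additive])+

lemmas additive_ops =
  additive_extension_additive[of dG_term, OF additive_dG_term]
  additive_extension_additive[of dS_term, OF additive_dS_term]
  additive_extension_additive[of cone_term, OF additive_cone_term]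
  additive_extension_additive[of "split_term A" for A, OF additive_split_term]
  additive_extension_additive[of "prism_term k" for k, OF additive_prism_term]
  additive_extension_additive[of "shift_term k" for k, OF additive_shift_term]
  additive_extension_additive[of "coeff_term k" for k, OF additive_coeff_term]

lemmas ext_single =
  additive_extension_single[where f=dG_term, OF additive_dG_term]
  additive_extension_single[where f=dS_term, OF additive_dS_term]
  additive_extension_single[where f=cone_term, OF additive_cone_term]
  additive_extension_single[where f="split_term A" for A, OF additive_split_term]
  additive_extension_single[where f="prism_term k" for k, OF additive_prism_term]
  additive_extension_single[where f="shift_term k" for k, OF additive_shift_term]
  additive_extension_single[where f="coeff_term k" for k, OF additive_coeff_term]

lemma pact_prods: "g \<in> carrier G \<Longrightarrow> \<sigma> \<in> prods \<Longrightarrow> pact g \<sigma> \<in> prods"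
  by (cases \<sigma>) (auto simp: prods_def sact_closed)

lemma add_subgroup_Ch: "add_subgroup (Ch q p)"
  unfolding Ch_def by (rule add_subgroup_chains[OF M])

lemma single_Ch:
  "set hs \<subseteq> carrier G \<Longrightarrow> set ts \<subseteq> S \<Longrightarrow> length hs = q \<Longrightarrow> length ts = p \<Longrightarrow> m \<in> M \<Longrightarrow>
    Poly_Mapping.single (hs, ts) m \<in> Ch q p"
  unfolding Ch_def by (rule single_in_chains[OF M]) (auto simp: prods_def)

lemma dG_Ch: "c \<in> Ch (Suc q) p \<Longrightarrow> dG c \<in> Ch q p"
  unfolding Ch_def[of "Suc q"]
  by (erule additive_extension_closed[OF additive_dG_term add_subgroup_Ch])
     (auto simp: prods_def intro!: alt_faces_closed add_subgroup_Ch single_Ch; blast)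

lemma dS_Ch: "c \<in> Ch q (Suc p) \<Longrightarrow> dS c \<in> Ch q p"
  unfolding Ch_def[of q "Suc p"]
  by (erule additive_extension_closed[OF additive_dS_term add_subgroup_Ch])
     (auto simp: prods_def intro!: alt_faces_closed add_subgroup_Ch single_Ch; blast)

lemma cone_Ch: "c \<in> Ch (Suc q) p \<Longrightarrow> germ_cone c \<in> Ch (Suc q) (Suc p)"
  unfolding Ch_def[of "Suc q" p]
  by (erule additive_extension_closed[OF additive_cone_term add_subgroup_Ch])
     (auto simp: prods_def length_Suc_conv intro!: single_Ch sact_closed s0; blast)

text \<open>Deleting vertices commutes with translation, so the boundary of a generating relation is
  an alternating sum of generating relations.\<close>

lemma dG_R: "r \<in> R \<Longrightarrow> dG r \<in> R"
proof (erule additive_extension_rel[OF additive_dG_term add_subgroup_rel])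
  fix m g \<sigma> assume m: "m \<in> M" and "(g, \<sigma>) \<in> carrier G \<times> prods"
  then obtain hs ts where \<sigma>: "\<sigma> = (hs, ts)" "set hs \<subseteq> carrier G" "set ts \<subseteq> S" "g \<in> carrier G"
    by (auto simp: prods_def)
  show "dG_term \<sigma> (act m g) - dG_term (pact g \<sigma>) m \<in> R"
    unfolding \<sigma> dG_term.simps pact.simps alt_faces_map alt_faces_diff[symmetric]
    by (rule alt_faces_closed[OF add_subgroup_rel])
       (auto intro!: rel_generator' m \<sigma> subset_trans[OF _ \<sigma>(2)])
qed

lemma dS_R: "r \<in> R \<Longrightarrow> dS r \<in> R"
proof (erule additive_extension_rel[OF additive_dS_term add_subgroup_rel])
  fix m g \<sigma> assume m: "m \<in> M" and "(g, \<sigma>) \<in> carrier G \<times> prods"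
  then obtain hs ts where \<sigma>: "\<sigma> = (hs, ts)" "set hs \<subseteq> carrier G" "set ts \<subseteq> S" "g \<in> carrier G"
    by (auto simp: prods_def)
  show "dS_term \<sigma> (act m g) - dS_term (pact g \<sigma>) m \<in> R"
    unfolding \<sigma> dS_term.simps pact.simps alt_faces_map alt_faces_diff[symmetric]
    by (rule alt_faces_closed[OF add_subgroup_rel])
       (auto intro!: rel_generator' m \<sigma> subset_trans[OF _ \<sigma>(3)])
qed

lemma cone_R: "r \<in> R \<Longrightarrow> germ_cone r \<in> R"
proof (erule additive_extension_rel[OF additive_cone_term add_subgroup_rel])
  fix m g \<sigma> assume m: "m \<in> M" and "(g, \<sigma>) \<in> carrier G \<times> prods"
  then obtain hs ts where \<sigma>: "\<sigma> = (hs, ts)" "set hs \<subseteq> carrier G" "set ts \<subseteq> S" "g \<in> carrier G"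
    by (auto simp: prods_def)
  show "cone_term \<sigma> (act m g) - cone_term (pact g \<sigma>) m \<in> R"
  proof (cases hs)
    case Nil
    then show ?thesis by (simp add: \<sigma>(1) rel.zero)
  next
    case (Cons h hs')
    then show ?thesis
      using m \<sigma> rel_generator'[of m g hs "sact h s0 # ts"]
      by (auto simp: sact_mult s0 sact_closed)
  qed
qed

lemma dG_dG: "c \<in> Ch q p \<Longrightarrow> dG (dG c) = 0"
  unfolding Ch_def
  by (erule additive_eq_on_chains[OF additive_comp[OF additive_ops(1,1)] additive_zero])
     (auto simp: ext_single additive_alt_faces[OF additive_ops(1)] alt_faces_alt_faces)

lemma dS_dS: "c \<in> Ch q p \<Longrightarrow> dS (dS c) = 0"
  unfolding Ch_def
  by (erule additive_eq_on_chains[OF additive_comp[OF additive_ops(2,2)] additive_zero])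
     (auto simp: ext_single additive_alt_faces[OF additive_ops(2)] alt_faces_alt_faces)

lemma dS_dG: "c \<in> Ch q p \<Longrightarrow> dS (dG c) = dG (dS c)"
  unfolding Ch_def
  by (erule additive_eq_on_chains[OF additive_comp[OF additive_ops(2,1)]
        additive_comp[OF additive_ops(1,2)]])
     (auto simp: ext_single additive_alt_faces[OF additive_ops(1)]
        additive_alt_faces[OF additive_ops(2)]
        alt_faces_commute[of "\<lambda>xs ys. Poly_Mapping.single (xs, ys) _"])

text \<open>The first face of the cone is the simplex itself. At \<open>p = 0\<close> the last term
  vanishes, so a chain without germ vertices is the \<open>dS\<close>-boundary of its cone.\<close>

lemma dS_cone: "c \<in> Ch (Suc q) p \<Longrightarrow> dS (germ_cone c) = c - germ_cone (dS c)"
proof -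
  have diff: "Modules.additive (\<lambda>c. c - germ_cone (dS c))"
    using additive.add[OF additive_ops(3)] additive.add[OF additive_ops(2)]
    by (simp add: Modules.additive_def)
  assume "c \<in> Ch (Suc q) p"
  then show ?thesis
    unfolding Ch_def
    by (rule additive_eq_on_chains[OF additive_comp[OF additive_ops(2,3)] diff])
       (auto simp: ext_single additive_alt_faces[OF additive_ops(3)])
qed

section \<open>Vanishing for germ stabilizers\<close>

lemma sact_inv: "g \<in> carrier G \<Longrightarrow> s \<in> S \<Longrightarrow> sact (inv g) (sact g s) = s"
  by (metis inv_closed l_inv sact_mult sact_one)

lemma Ch_0_R: "c \<in> Ch 0 p \<Longrightarrow> c \<in> R"
  unfolding Ch_def
proof (erule additive_closed_on_chains[of "\<lambda>c. c", OF _ add_subgroup_rel, rotated])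
  fix \<sigma> m assume "\<sigma> \<in> {(hs, ts) \<in> prods. length hs = 0 \<and> length ts = p}" and m: "m \<in> M"
  then obtain ts where \<sigma>: "\<sigma> = ([], ts)" "set ts \<subseteq> S" by (auto simp: prods_def)
  obtain A K where A: "A ` M \<subseteq> M" and K: "finite K" "K \<subseteq> carrier G"
    and fix_ts: "\<forall>k\<in>K. \<forall>s\<in>set ts. sact k s = s"
    and split: "\<forall>m\<in>M. m = (\<Sum>k\<in>K. A m - act (A m) k)"
    using splitting[of "{}" "set ts"] \<sigma>(2) by blast
  have "Poly_Mapping.single \<sigma> (A m - act (A m) k) \<in> R" if "k \<in> K" for k
  proof -
    have "map (sact k) ts = ts" using fix_ts that by (simp add: map_idI)
    moreover have "Poly_Mapping.single ([], ts) (act (A m) k)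
        - Poly_Mapping.single (map ((\<otimes>) k) [], map (sact k) ts) (A m) \<in> R"
      by (rule rel_generator') (use A m K that \<sigma> in auto)
    ultimately have "- Poly_Mapping.single \<sigma> (A m - act (A m) k) \<in> R"
      using \<sigma> by (simp add: single_diff)
    then show ?thesis using add_subgroup_uminus[OF add_subgroup_rel] by fastforce
  qed
  then have "Poly_Mapping.single \<sigma> (\<Sum>k\<in>K. A m - act (A m) k) \<in> R"
    by (simp add: additive.sum[OF additive_single] add_subgroup_sum add_subgroup_rel)
  then show "Poly_Mapping.single \<sigma> m \<in> R" using split m by metis
qed (simp add: Modules.additive_def)

text \<open>Left translation of the group vertices of a simplex \<open>(hs, ts)\<close> by a conjugate of \<open>k\<close>
  that fixes \<open>ts\<close> acts on the coinvariants as \<open>k\<close> does on coefficients, and the prism makes it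
  homotopic to the identity. The conjugating element depends on \<open>hd ts\<close> only, which makes this
  compatible with the finitely many relations used by \<open>c\<close>.\<close>

lemma coinvariants_acyclic:
  assumes c: "c \<in> Ch q (Suc p)" and dc: "dG c \<in> R"
  shows "\<exists>e\<in>Ch (Suc q) (Suc p). c - dG e \<in> R"
proof -
  obtain W0 where W0: "finite W0" "W0 \<subseteq> carrier G \<times> prods" "dG c \<in> rel W0"
    using rel_finite_support[OF dc] by blast
  define W where "W = {w \<in> W0. snd (snd w) \<noteq> []}"
  \<comment> \<open>The stabilizer element measuring how far the chosen lifts are from being
    equivariant: \<open>g \<otimes> lift_germ s = lift_germ (sact g s) \<otimes> move g
    s\<close>.\<close>
  define move where "move g s = inv (lift_germ (sact g s)) \<otimes> g \<otimes> lift_germ s" for g s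
  define F where "F = (\<lambda>(g, hs, ts). move g (hd ts)) ` W"
  \<comment> \<open>The germ vertices moved back to the base germ: if \<open>k\<close> fixes these,
    then \<open>conj_lift k ts\<close> fixes \<open>ts\<close>.\<close>
  define Q where "Q = (\<Union>(hs, ts)\<in>Poly_Mapping.keys c. sact (inv (lift_germ (hd ts))) ` set ts)"
  have W_elem: "g \<in> carrier G \<and> set hs \<subseteq> carrier G \<and> set ts \<subseteq> S \<and> ts \<noteq> [] \<and> hd ts \<in> S"
    if "(g, hs, ts) \<in> W" for g hs ts
    using that W0(2) hd_in_set[of ts] by (fastforce simp: W_def prods_def)
  have key: "set hs \<subseteq> carrier G \<and> set ts \<subseteq> S \<and> length hs = q \<and> length ts = Suc p \<and> ts \<noteq> [] \<and> hd ts \<in> S"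
    if "(hs, ts) \<in> Poly_Mapping.keys c" for hs ts
  proof -
    have "set hs \<subseteq> carrier G" "set ts \<subseteq> S" "length hs = q" "length ts = Suc p"
      using that c by (auto simp: Ch_def chains_def prods_def)
    then show ?thesis using hd_in_set[of ts] by (cases ts) auto
  qed
  have "finite F" using W0(1) by (simp add: F_def W_def)
  moreover have "F \<subseteq> {g \<in> carrier G. sact g s0 = s0}"
  proof
    fix f assume "f \<in> F"
    then obtain g hs ts where w: "(g, hs, ts) \<in> W" and f: "f = move g (hd ts)"
      by (auto simp: F_def)
    note el = W_elem[OF w]
    have "sact f s0 = sact (inv (lift_germ (sact g (hd ts)))) (sact g (hd ts))"
      using el by (simp add: f move_def sact_mult lift_germ sact_closed s0)
    also have "\<dots> = s0"
      using el sact_inv[of "lift_germ (sact g (hd ts))" s0]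
      by (simp add: lift_germ sact_closed s0)
    finally show "f \<in> {g \<in> carrier G. sact g s0 = s0}"
      using el by (simp add: f move_def lift_germ sact_closed)
  qed
  moreover have "finite Q" by (auto simp: Q_def)
  moreover have "Q \<subseteq> S" using key by (fastforce simp: Q_def intro!: sact_closed lift_germ)
  ultimately obtain A K where addA: "Modules.additive A" and A: "A ` M \<subseteq> M"
    and K: "finite K" "K \<subseteq> carrier G"
    and comm: "\<forall>f\<in>F. \<forall>m\<in>M. A (act m f) = act (A m) f" "\<forall>f\<in>F. \<forall>k\<in>K. f \<otimes> k = k \<otimes> f"
    and fixQ: "\<forall>k\<in>K. \<forall>s\<in>Q. sact k s = s"
    and split: "\<forall>m\<in>M. m = (\<Sum>k\<in>K. A m - act (A m) k)"
    using splitting[of F Q] by blast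
  have K_carr: "k \<in> K \<Longrightarrow> k \<in> carrier G" for k using K by auto
  have AM: "m \<in> M \<Longrightarrow> A m \<in> M" for m using A by auto
  define E where "E = additive_extension (split_term A)"
  define P where "P k = additive_extension (prism_term k)" for k
  define U where "U k = additive_extension (shift_term k)" for k
  define B where "B k = additive_extension (coeff_term k)" for k
  have addE: "Modules.additive E" and addP: "Modules.additive (P k)"
    and addU: "Modules.additive (U k)" and addB: "Modules.additive (B k)" for k
    unfolding E_def P_def U_def B_def by (rule additive_ops additive_ops(4)[OF addA])+
  note E_single = ext_single(4)[OF addA, folded E_def]
  note P_single = ext_single(5)[folded P_def]
  note U_single = ext_single(6)[folded U_def]
  note B_single = ext_single(7)[folded B_def]

  have conj_carr: "conj_lift k ts \<in> carrier G" if "k \<in> K" "ts \<noteq> []" "set ts \<subseteq> S" for k ts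
  proof -
    have "hd ts \<in> S" using that by auto
    then show ?thesis by (simp add: conj_lift_def K_carr that lift_germ)
  qed
  have move_eq: "g \<otimes> lift_germ (hd ts) = lift_germ (sact g (hd ts)) \<otimes> move g (hd ts)"
    "inv (lift_germ (sact g (hd ts))) \<otimes> g = move g (hd ts) \<otimes> inv (lift_germ (hd ts))"
    "move g (hd ts) \<in> carrier G" "move g (hd ts) \<in> F"
    if "(g, hs, ts) \<in> W" for g hs ts
  proof -
    have carr: "g \<in> carrier G" "lift_germ (hd ts) \<in> carrier G" "lift_germ (sact g (hd ts)) \<in> carrier G"
      using W_elem[OF that] by (auto simp: lift_germ sact_closed)
    then show "g \<otimes> lift_germ (hd ts) = lift_germ (sact g (hd ts)) \<otimes> move g (hd ts)"
      by (simp add: move_def m_assoc[symmetric])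
    show "inv (lift_germ (sact g (hd ts))) \<otimes> g = move g (hd ts) \<otimes> inv (lift_germ (hd ts))"
      using carr by (simp add: move_def m_assoc)
    show "move g (hd ts) \<in> carrier G" using carr by (simp add: move_def)
    show "move g (hd ts) \<in> F" using that by (force simp: F_def)
  qed
  \<comment> \<open>The two conjugates of \<open>k\<close> differ by conjugation with
    \<open>move g (hd ts)\<close>, which lies in \<open>F\<close> and commutes with
    \<open>k\<close>.\<close>
  have conj_equivariant: "conj_lift k (map (sact g) ts) \<otimes> g = g \<otimes> conj_lift k ts"
    if w: "(g, hs, ts) \<in> W" and k: "k \<in> K" for g hs ts k
  proof -
    define L L' f where "L = lift_germ (hd ts)" "L' = lift_germ (sact g (hd ts))" "f = move g (hd ts)"
    have carr: "g \<in> carrier G" "L \<in> carrier G" "L' \<in> carrier G" "f \<in> carrier G" "k \<in> carrier G"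
      using W_elem[OF w] move_eq[OF w] K_carr[OF k] by (auto simp: L_L'_f_def lift_germ sact_closed)
    have "conj_lift k (map (sact g) ts) \<otimes> g = L' \<otimes> k \<otimes> (inv L' \<otimes> g)"
      using W_elem[OF w] carr by (simp add: conj_lift_def L_L'_f_def(1,2)[symmetric] hd_map m_assoc)
    also have "\<dots> = L' \<otimes> (k \<otimes> f) \<otimes> inv L"
      using move_eq(2)[OF w] carr by (simp add: L_L'_f_def[symmetric] m_assoc)
    also have "k \<otimes> f = f \<otimes> k"
      using comm(2) move_eq(4)[OF w] k by (simp add: L_L'_f_def)
    also have "L' \<otimes> (f \<otimes> k) \<otimes> inv L = (L' \<otimes> f) \<otimes> k \<otimes> inv L"
      using carr by (simp add: m_assoc)
    also have "L' \<otimes> f = g \<otimes> L"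
      using move_eq(1)[OF w] by (simp add: L_L'_f_def)
    finally show ?thesis using carr by (simp add: conj_lift_def L_L'_f_def(1)[symmetric] m_assoc)
  qed
  \<comment> \<open>The same comparison of lifts on coefficients, now using that \<open>A\<close>
    commutes with the action of \<open>F\<close>.\<close>
  have E_equivariant: "act (A (act (act m g) (lift_germ (hd ts)))) (inv (lift_germ (hd ts)))
      = act (act (A (act m (lift_germ (sact g (hd ts))))) (inv (lift_germ (sact g (hd ts))))) g"
    if w: "(g, hs, ts) \<in> W" and m: "m \<in> M" for g hs ts m
  proof -
    define L L' f where "L = lift_germ (hd ts)" "L' = lift_germ (sact g (hd ts))" "f = move g (hd ts)"
    have carr: "g \<in> carrier G" "L \<in> carrier G" "L' \<in> carrier G" "f \<in> carrier G"
      using W_elem[OF w] move_eq[OF w] by (auto simp: L_L'_f_def lift_germ sact_closed)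
    have "act (act m g) L = act (act m L') f"
      using move_eq(1)[OF w] carr m by (simp add: L_L'_f_def[symmetric] act_mult[symmetric])
    then have "act (A (act (act m g) L)) (inv L) = act (act (A (act m L')) f) (inv L)"
      using comm(1) move_eq(4)[OF w] act_closed[OF m carr(3)] by (simp add: L_L'_f_def)
    also have "\<dots> = act (act (A (act m L')) (inv L')) g"
      using move_eq(2)[OF w] carr m
      by (simp add: L_L'_f_def[symmetric] act_mult[symmetric] AM act_closed)
    finally show ?thesis by (simp add: L_L'_f_def)
  qed

  define d where "d = E c"
  have c': "c \<in> chains (Poly_Mapping.keys c) M"
    using c by (auto simp: Ch_def chains_def)
  have d: "d \<in> Ch q (Suc p)"
    unfolding d_def
    by (rule additive_closed_on_chains[OF addE add_subgroup_Ch c'])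
       (auto simp: E_single dest!: key intro!: single_Ch act_closed AM lift_germ inv_closed)
  \<comment> \<open>Landing in \<open>rel W\<close> rather than merely in \<open>R\<close> is
    essential: the prism is equivariant only for the pairs in \<open>W\<close>.\<close>
  have E_rel: "E (dG c) \<in> rel W"
    unfolding E_def
  proof (rule additive_extension_rel[OF additive_split_term[OF addA] add_subgroup_rel W0(3)])
    fix m g \<sigma> assume m: "m \<in> M" and w: "(g, \<sigma>) \<in> W0"
    obtain hs ts where \<sigma>: "\<sigma> = (hs, ts)" by fastforce
    show "split_term A \<sigma> (act m g) - split_term A (pact g \<sigma>) m \<in> rel W"
    proof (cases "ts = []")
      case True
      then show ?thesis by (simp add: \<sigma> rel.zero)
    next
      case False
      then have w': "(g, hs, ts) \<in> W" using w by (simp add: W_def \<sigma>)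
      show ?thesis
        using rel_generator[OF _ w', of "act (A (act m (lift_germ (sact g (hd ts)))))
              (inv (lift_germ (sact g (hd ts))))"] False W_elem[OF w'] m
        by (simp add: \<sigma> E_equivariant[OF w' m] hd_map act_closed AM lift_germ sact_closed)
    qed
  qed
  have dG_d: "dG d = E (dG c)"
  proof -
    have "(\<lambda>c. dG (E c)) c = (\<lambda>c. E (dG c)) c"
      by (rule additive_eq_on_chains[OF additive_comp additive_comp c'])
         (auto simp: additive_ops addE ext_single E_single additive_alt_faces[OF addE] dest!: key)
    then show ?thesis by (simp add: d_def)
  qed
  have P_rel: "P k (dG d) \<in> R" if k: "k \<in> K" for k
    unfolding P_def dG_d
  proof (rule additive_extension_rel[OF additive_prism_term add_subgroup_rel E_rel])
    fix m g \<sigma> assume m: "m \<in> M" and w: "(g, \<sigma>) \<in> W"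
    obtain hs ts where \<sigma>: "\<sigma> = (hs, ts)" by fastforce
    note el = W_elem[OF w[unfolded \<sigma>]]
    have "set (map (sact g) ts) \<subseteq> S" using pact_prods[of g "(hs, ts)"] el by (simp add: prods_def)
    then have u: "conj_lift k ts \<in> carrier G" "conj_lift k (map (sact g) ts) \<in> carrier G"
      using el by (simp_all add: conj_carr k del: set_map)
    have equiv: "conj_lift k (map (sact g) ts) \<otimes> (g \<otimes> h) = g \<otimes> (conj_lift k ts \<otimes> h)"
      if "h \<in> set hs" for h
    proof -
      have "h \<in> carrier G" using that el by blast
      then show ?thesis
        using el u conj_equivariant[OF w[unfolded \<sigma>] k] by (simp add: m_assoc[symmetric])
    qed
    have "prism_term k \<sigma> (act m g) - prism_term k (pact g \<sigma>) m
        = prism (\<lambda>ys. Poly_Mapping.single (ys, ts) (act m g)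
            - Poly_Mapping.single (map ((\<otimes>) g) ys, map (sact g) ts) m) ((\<otimes>) (conj_lift k ts)) hs"
      unfolding \<sigma> prism_term.simps pact.simps prism_diff
      by (simp only: prism_map[where h = "(\<otimes>) g" and u = "(\<otimes>) (conj_lift k ts)", OF equiv])
    also have "\<dots> \<in> R"
    proof (rule prism_closed[OF add_subgroup_rel])
      fix ys assume "set ys \<subseteq> set hs \<union> (\<otimes>) (conj_lift k ts) ` set hs"
      moreover have "(\<otimes>) (conj_lift k ts) ` set hs \<subseteq> carrier G" using el u(1) by blast
      ultimately have "set ys \<subseteq> carrier G" using el by blast
      then show "Poly_Mapping.single (ys, ts) (act m g)
          - Poly_Mapping.single (map ((\<otimes>) g) ys, map (sact g) ts) m \<in> R"
        using rel_generator' m el by blast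
    qed
    finally show "prism_term k \<sigma> (act m g) - prism_term k (pact g \<sigma>) m \<in> R" .
  qed
  have P_Ch: "P k d \<in> Ch (Suc q) (Suc p)" if k: "k \<in> K" for k
    unfolding P_def
  proof (rule additive_extension_closed[OF additive_prism_term add_subgroup_Ch d[unfolded Ch_def]])
    fix \<sigma> m assume \<sigma>: "\<sigma> \<in> {(hs, ts) \<in> prods. length hs = q \<and> length ts = Suc p}" and m: "m \<in> M"
    obtain hs ts where \<sigma>': "\<sigma> = (hs, ts)" by fastforce
    have \<sigma>'': "set hs \<subseteq> carrier G" "set ts \<subseteq> S" "length hs = q" "length ts = Suc p"
      using \<sigma> by (auto simp: \<sigma>' prods_def)
    then have "conj_lift k ts \<in> carrier G" by (intro conj_carr k) auto
    then have "(\<otimes>) (conj_lift k ts) ` set hs \<subseteq> carrier G" using \<sigma>'' by blast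
    then have "set ys \<subseteq> carrier G" if "set ys \<subseteq> set hs \<union> (\<otimes>) (conj_lift k ts) ` set hs" for ys
      using that \<sigma>'' by blast
    then show "prism_term k \<sigma> m \<in> Ch (Suc q) (Suc p)"
      using m \<sigma>'' unfolding \<sigma>' prism_term.simps
      by (intro prism_closed[OF add_subgroup_Ch] single_Ch) auto
  qed
  have homotopy: "P k (dG d) + dG (P k d) = U k d - d" for k
  proof -
    have "(\<lambda>d. P k (dG d) + dG (P k d)) d = (\<lambda>d. U k d - d) d"
    proof (rule additive_eq_on_chains[OF _ _ d[unfolded Ch_def]])
      show "Modules.additive (\<lambda>d. P k (dG d) + dG (P k d))" "Modules.additive (\<lambda>d. U k d - d)"
        using additive.add[OF addP] additive.add[OF addU] additive.add[OF additive_ops(1)]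
        by (simp_all add: Modules.additive_def)
      fix \<sigma> :: "'a list \<times> 's list" and m
      obtain hs ts where \<sigma>: "\<sigma> = (hs, ts)" by fastforce
      show "P k (dG (Poly_Mapping.single \<sigma> m)) + dG (P k (Poly_Mapping.single \<sigma> m))
        = U k (Poly_Mapping.single \<sigma> m) - Poly_Mapping.single \<sigma> m"
        using prism_homotopy[of "\<lambda>ys. Poly_Mapping.single (ys, ts) m" "(\<otimes>) (conj_lift k ts)" hs]
        by (simp add: \<sigma> P_single U_single ext_single additive_alt_faces[OF addP]
            additive_prism[OF additive_ops(1)] add.commute)
    qed
    then show ?thesis .
  qed
  \<comment> \<open>Since \<open>conj_lift k ts\<close> fixes \<open>ts\<close>, its generating
    relation trades the action on the coefficient for translation of the group vertices
    alone.\<close>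
  have BU: "B k d - U k d \<in> R" if k: "k \<in> K" for k
  proof -
    have "(\<lambda>c. B k (E c) - U k (E c)) c \<in> R"
    proof (rule additive_closed_on_chains[OF _ add_subgroup_rel c'])
      show "Modules.additive (\<lambda>c. B k (E c) - U k (E c))"
        using additive.add[OF addB] additive.add[OF addU] additive.add[OF addE]
        by (simp add: Modules.additive_def)
      fix \<sigma> m assume \<sigma>: "\<sigma> \<in> Poly_Mapping.keys c" and m: "m \<in> M"
      obtain hs ts where \<sigma>': "\<sigma> = (hs, ts)" by fastforce
      note el = key[OF \<sigma>[unfolded \<sigma>']]
      have u: "conj_lift k ts \<in> carrier G" using el by (auto intro!: conj_carr k)
      have "sact (conj_lift k ts) s = s" if s: "s \<in> set ts" for s
      proof -
        define L where "L = lift_germ (hd ts)"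
        have carr: "L \<in> carrier G" "k \<in> carrier G" "s \<in> S" using el s K_carr[OF k]
          by (auto simp: L_def lift_germ)
        have "sact (inv L) s \<in> Q" using \<sigma> s unfolding Q_def \<sigma>' L_def by force
        then have "sact k (sact (inv L) s) = sact (inv L) s" using fixQ k by blast
        then have "sact (conj_lift k ts) s = sact L (sact (inv L) s)"
          using carr by (simp add: conj_lift_def L_def[symmetric] sact_mult sact_closed)
        also have "\<dots> = s" using carr by (simp add: sact_mult[symmetric] sact_one)
        finally show ?thesis .
      qed
      then have fix_ts: "map (sact (conj_lift k ts)) ts = ts" by (simp add: map_idI)
      show "B k (E (Poly_Mapping.single \<sigma> m)) - U k (E (Poly_Mapping.single \<sigma> m)) \<in> R"
        using rel_generator'[OF _ u, of "act (A (act m (lift_germ (hd ts)))) (inv (lift_germ (hd ts)))" hs ts]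
          el m by (simp add: \<sigma>' E_single B_single U_single fix_ts act_closed AM lift_germ)
    qed
    then show ?thesis by (simp add: d_def)
  qed
  \<comment> \<open>Splitting \<open>act m L\<close> at the base germ and then acting by
    \<open>inv L\<close> turns the action of \<open>k\<close> into that of
    \<open>conj_lift k ts\<close>.\<close>
  have c_split: "c = (\<Sum>k\<in>K. d - B k d)"
  proof -
    have "(\<lambda>c. c) c = (\<lambda>c. \<Sum>k\<in>K. E c - B k (E c)) c"
    proof (rule additive_eq_on_chains[OF _ _ c'])
      show "Modules.additive (\<lambda>c. c)" "Modules.additive (\<lambda>c. \<Sum>k\<in>K. E c - B k (E c))"
        using additive.add[OF addB] additive.add[OF addE]
        by (simp_all add: Modules.additive_def sum.distrib[symmetric] algebra_simps)
      fix \<sigma> m assume \<sigma>: "\<sigma> \<in> Poly_Mapping.keys c" and m: "m \<in> M"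
      obtain hs ts where \<sigma>': "\<sigma> = (hs, ts)" by fastforce
      note el = key[OF \<sigma>[unfolded \<sigma>']]
      define L where "L = lift_germ (hd ts)"
      define n where "n = A (act m L)"
      have L: "L \<in> carrier G" using el by (simp add: L_def lift_germ)
      have n: "n \<in> M" using L m by (simp add: n_def AM act_closed)
      have "act (act n (inv L)) (conj_lift k ts) = act (act n k) (inv L)" if "k \<in> K" for k
      proof -
        have "inv L \<otimes> (L \<otimes> k \<otimes> inv L) = k \<otimes> inv L"
          using L K_carr[OF that] by (simp add: m_assoc[symmetric])
        then show ?thesis
          using L K_carr[OF that] n
          by (simp add: conj_lift_def L_def[symmetric] act_mult[symmetric])
      qed
      then have "(\<Sum>k\<in>K. act n (inv L) - act (act n (inv L)) (conj_lift k ts))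
          = act (\<Sum>k\<in>K. n - act n k) (inv L)"
        by (simp add: act_sum act_diff)
      also have "(\<Sum>k\<in>K. n - act n k) = act m L"
        using split act_closed[OF m L] by (simp add: n_def)
      also have "act (act m L) (inv L) = m"
        using L m by (simp add: act_mult[symmetric] act_one)
      finally have "m = (\<Sum>k\<in>K. act n (inv L) - act (act n (inv L)) (conj_lift k ts))" by simp
      then have "Poly_Mapping.single \<sigma> m
          = (\<Sum>k\<in>K. Poly_Mapping.single \<sigma> (act n (inv L) - act (act n (inv L)) (conj_lift k ts)))"
        by (metis additive.sum[OF additive_single])
      moreover have "E (Poly_Mapping.single \<sigma> m) = Poly_Mapping.single \<sigma> (act n (inv L))"
        using el by (simp add: \<sigma>' E_single n_def L_def)
      moreover have "B k (Poly_Mapping.single \<sigma> x) = Poly_Mapping.single \<sigma> (act x (conj_lift k ts))" for k x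
        by (simp add: \<sigma>' B_single)
      ultimately show "Poly_Mapping.single \<sigma> m
          = (\<Sum>k\<in>K. E (Poly_Mapping.single \<sigma> m) - B k (E (Poly_Mapping.single \<sigma> m)))"
        by (simp only: single_diff)
    qed
    then show ?thesis by (simp add: d_def)
  qed
  \<comment> \<open>Modulo relations \<open>B k d\<close> equals \<open>U k d\<close>, and the
    homotopy gives \<open>U k d - d\<close> as \<open>dG (P k d)\<close>; since \<open>c\<close> is
    the sum of the \<open>d - B k d\<close>, the sign is negative.\<close>
  define e where "e = - (\<Sum>k\<in>K. P k d)"
  have "e \<in> Ch (Suc q) (Suc p)"
    unfolding e_def by (intro add_subgroup_uminus add_subgroup_sum add_subgroup_Ch P_Ch)
  moreover have "c - dG e = (\<Sum>k\<in>K. - (B k d - U k d) - P k (dG d))"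
  proof -
    have "d - B k d + dG (P k d) = - (B k d - U k d) - P k (dG d)" for k
      using homotopy[of k] by (simp add: algebra_simps)
    moreover have "c - dG e = (\<Sum>k\<in>K. (d - B k d) + dG (P k d))"
      using c_split by (simp add: e_def additive.minus[OF additive_ops(1)]
          additive.sum[OF additive_ops(1)] sum.distrib)
    ultimately show ?thesis by (simp only:)
  qed
  moreover have "(\<Sum>k\<in>K. - (B k d - U k d) - P k (dG d)) \<in> R"
    by (intro add_subgroup_sum add_subgroup_rel add_subgroup_diff add_subgroup_uminus BU P_rel)
  ultimately show ?thesis by (intro bexI[of _ e]) simp_all
qed

text \<open>Dimension shifting: the cone with apex the germ of the first group vertex is equivariant and
  contracts the \<open>S\<close>-direction, which trades one group vertex for one vertex in \<open>S\<close>.\<close>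

theorem double_complex_filling:
  assumes "c \<in> Ch q p" "dG c \<in> R" "dS c \<in> R"
  shows "\<exists>e\<in>Ch (Suc q) p. c - dG e \<in> R \<and> dS e \<in> R"
  using assms
proof (induction q arbitrary: p c)
  case 0
  have "0 \<in> Ch (Suc 0) p" by (rule add_subgroup_zero[OF add_subgroup_Ch])
  with Ch_0_R[OF 0(1)] show ?case
    by (intro bexI[of _ 0]) (simp_all add: additive_extension_def rel.zero)
next
  case (Suc q)
  note R_diff = add_subgroup_diff[OF add_subgroup_rel]
  \<comment> \<open>Modulo relations \<open>dS c'\<close> is \<open>c\<close>, and
    \<open>dG c'\<close> is a cycle in both directions with one group vertex fewer, so the induction
    hypothesis applies to it.\<close>
  define c' where "c' = germ_cone c"
  have c': "c' \<in> Ch (Suc q) (Suc p)" unfolding c'_def by (rule cone_Ch) fact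
  have dSc': "dS c' = c - germ_cone (dS c)" unfolding c'_def by (rule dS_cone) fact
  have "dG (dG c') \<in> R" using dG_dG[OF c'] by (simp add: rel.zero)
  moreover have "dS (dG c') \<in> R"
    using dS_dG[OF c'] Suc.prems dG_R[OF cone_R[OF Suc.prems(3)]]
    by (simp add: dSc' additive.diff[OF additive_ops(1)] R_diff)
  ultimately obtain e' where e': "e' \<in> Ch (Suc q) (Suc p)" "dG c' - dG e' \<in> R" "dS e' \<in> R"
    using Suc.IH[OF dG_Ch[OF c']] by blast
  \<comment> \<open>The correction by \<open>e'\<close> makes this a \<open>dG\<close>-cycle modulo
    \<open>R\<close>; having a germ vertex, it can be filled by the vanishing for germ
    stabilizers.\<close>
  have "c' - e' \<in> Ch (Suc q) (Suc p)" using c' e' by (intro add_subgroup_diff add_subgroup_Ch)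
  moreover have "dG (c' - e') \<in> R" using e' by (simp add: additive.diff[OF additive_ops(1)])
  ultimately obtain f where f: "f \<in> Ch (Suc (Suc q)) (Suc p)" "c' - e' - dG f \<in> R"
    using coinvariants_acyclic by blast
  \<comment> \<open>Applying \<open>dS\<close> turns the filling of \<open>c' - e'\<close> into one
    of \<open>c\<close>. That \<open>dS e'\<close> is a relation is the second part of the induction
    hypothesis, which is why the conclusion carries it.\<close>
  have "dS (c' - e' - dG f) + dS e' + germ_cone (dS c) \<in> R"
    by (intro add_subgroup_add add_subgroup_rel dS_R f e' cone_R Suc.prems)
  moreover have "dS (c' - e' - dG f) + dS e' + germ_cone (dS c) = c - dG (dS f)"
    using dS_dG[OF f(1)] by (simp add: additive.diff[OF additive_ops(2)] dSc')
  ultimately have "c - dG (dS f) \<in> R" by simp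
  moreover have "dS (dS f) \<in> R" using dS_dS[OF f(1)] by (simp add: rel.zero)
  ultimately show ?case using dS_Ch[OF f(1)] by blast
qed

end

section \<open>Comparison with the bar complex\<close>

context group begin

text \<open>Consecutive quotients are invariant under left translation and determine a nonempty list
  up to its first vertex, so every orbit contains a unique
  \<open>path_from \<one> xs\<close>.\<close>

fun inhom :: "'a list \<Rightarrow> 'a list" where
  "inhom [] = []"
| "inhom [h] = []"
| "inhom (h # h' # hs) = (inv h \<otimes> h') # inhom (h' # hs)"

fun path_from :: "'a \<Rightarrow> 'a list \<Rightarrow> 'a list" where
  "path_from h [] = [h]"
| "path_from h (x # xs) = h # path_from (h \<otimes> x) xs"

lemma length_inhom [simp]: "length (inhom hs) = length hs - 1"
  by (induction hs rule: inhom.induct) auto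

lemma set_inhom: "set hs \<subseteq> carrier G \<Longrightarrow> set (inhom hs) \<subseteq> carrier G"
  by (induction hs rule: inhom.induct) auto

lemma length_path_from [simp]: "length (path_from h xs) = Suc (length xs)"
  by (induction xs arbitrary: h) auto

lemma path_from_not_Nil [simp]: "path_from h xs \<noteq> []"
  by (cases xs) auto

lemma hd_path_from [simp]: "hd (path_from h xs) = h"
  by (cases xs) auto

lemma set_path_from:
  "h \<in> carrier G \<Longrightarrow> set xs \<subseteq> carrier G \<Longrightarrow> set (path_from h xs) \<subseteq> carrier G"
  by (induction xs arbitrary: h) auto

lemma inhom_path_from:
  "h \<in> carrier G \<Longrightarrow> set xs \<subseteq> carrier G \<Longrightarrow> inhom (path_from h xs) = xs"
proof (induction xs arbitrary: h)
  case (Cons x xs)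
  obtain r where r: "path_from (h \<otimes> x) xs = (h \<otimes> x) # r"
    by (cases xs) auto
  with Cons.IH[of "h \<otimes> x"] Cons.prems have "inhom ((h \<otimes> x) # r) = xs" by auto
  then show ?case using Cons.prems r by (simp add: m_assoc[symmetric])
qed simp

lemma path_from_mult:
  "g \<in> carrier G \<Longrightarrow> h \<in> carrier G \<Longrightarrow> set xs \<subseteq> carrier G \<Longrightarrow>
    path_from (g \<otimes> h) xs = map ((\<otimes>) g) (path_from h xs)"
  by (induction xs arbitrary: h) (auto simp: m_assoc)

lemma path_from_inhom:
  "set (h # hs) \<subseteq> carrier G \<Longrightarrow> path_from h (inhom (h # hs)) = h # hs"
  by (induction hs arbitrary: h) (auto simp: m_assoc[symmetric])

lemma inhom_mult:
  "g \<in> carrier G \<Longrightarrow> set hs \<subseteq> carrier G \<Longrightarrow> inhom (map ((\<otimes>) g) hs) = inhom hs"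
proof (induction hs rule: inhom.induct)
  case (3 h h' hs)
  then have "inv g \<otimes> (g \<otimes> h') = h'" by (simp add: m_assoc[symmetric])
  with 3 show ?case by (simp add: inv_mult_group m_assoc)
qed auto

text \<open>Deleting an interior vertex multiplies the two quotients that meet there; deleting the
  last one drops the last quotient. The face opposite the first vertex is left out, as it also
  changes the coefficient.\<close>

lemma bar_face_inhom:
  assumes "set hs \<subseteq> carrier G" "Suc i < length hs"
  shows "bar_face G (Suc i) (inhom hs) = inhom (take (Suc i) hs @ drop (Suc (Suc i)) hs)"
  using assms
proof (induction i arbitrary: hs)
  case 0
  obtain h h' r where hs: "hs = h # h' # r"
    using 0(2) by (cases hs; cases "tl hs") auto
  show ?case
  proof (cases r)
    case Nil
    then show ?thesis by (simp add: hs bar_face_def)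
  next
    case (Cons h'' r')
    have "h' \<otimes> (inv h' \<otimes> h'') = h''" using 0 by (simp add: hs Cons m_assoc[symmetric])
    then show ?thesis using 0 by (simp add: hs Cons bar_face_def m_assoc)
  qed
next
  case (Suc i)
  obtain h h' r where hs: "hs = h # h' # r"
    using Suc.prems(2) by (cases hs; cases "tl hs") auto
  have IH: "bar_face G (Suc i) (inhom (h' # r)) = inhom (h' # (take i r @ drop (Suc i) r))"
    using Suc.IH[of "h' # r"] Suc.prems by (simp add: hs)
  have "inhom (h' # r) \<noteq> []" using Suc.prems(2) by (auto simp: hs simp flip: length_0_conv)
  then have "bar_face G (Suc (Suc i)) (inhom hs) = (inv h \<otimes> h') # bar_face G (Suc i) (inhom (h' # r))"
    by (simp add: hs bar_face_def)
  then show ?case by (simp add: IH hs)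
qed

end

section \<open>Identification of the coinvariants with bar chains\<close>

context germ_split begin

text \<open>The defining relations move the first vertex to \<open>\<one>\<close> at the price of
  letting it act on the coefficient.\<close>

fun bar_term :: "'a list \<times> 's list \<Rightarrow> 'm \<Rightarrow> ('a list \<Rightarrow>\<^sub>0 'm)" where
  "bar_term (hs, ts) m = (if hs = [] then 0 else Poly_Mapping.single (inhom hs) (act m (hd hs)))"

definition lift_term :: "'a list \<Rightarrow> 'm \<Rightarrow> ('a list \<times> 's list \<Rightarrow>\<^sub>0 'm)" where
  "lift_term xs = Poly_Mapping.single (path_from \<one> xs, [])"

lemma additive_bar_term: "Modules.additive (bar_term \<sigma>)"
  by (cases \<sigma>) (simp add: Modules.additive_def single_add additive.add[OF act_additive])

lemma additive_lift_term: "Modules.additive (lift_term \<sigma>)"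
  unfolding lift_term_def by (rule additive_single)

lemma additive_bar_boundary_term: "Modules.additive (\<lambda>m. bar_boundary_term G act m xs)"
proof
  fix m n :: 'm
  have "Poly_Mapping.single x (if even (i::nat) then m + n else - (m + n))
      = Poly_Mapping.single x (if even i then m else - m)
      + Poly_Mapping.single x (if even i then n else - n)" for i and x :: "'a list"
    by (cases "even i") (simp_all only: if_True if_False minus_add_distrib single_add)
  then show "bar_boundary_term G act (m + n) xs
      = bar_boundary_term G act m xs + bar_boundary_term G act n xs"
    by (simp add: bar_boundary_term_def single_add sum.distrib additive.add[OF act_additive])
qed

lemma bar_boundary_eq: "bar_boundary G act = additive_extension (\<lambda>xs m. bar_boundary_term G act m xs)"
  by (simp add: fun_eq_iff bar_boundary_def additive_extension_def)

abbreviation "to_bar \<equiv> additive_extension bar_term"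
abbreviation "of_bar \<equiv> additive_extension lift_term"

lemmas additive_bar =
  additive_extension_additive[of bar_term, OF additive_bar_term]
  additive_extension_additive[of lift_term, OF additive_lift_term]
  additive_extension_additive[of "\<lambda>xs m. bar_boundary_term G act m xs",
    OF additive_bar_boundary_term, folded bar_boundary_eq]

lemmas bar_single =
  additive_extension_single[where f = bar_term, OF additive_bar_term]
  additive_extension_single[where f = lift_term, OF additive_lift_term]
  additive_extension_single[where f = "\<lambda>xs m. bar_boundary_term G act m xs",
    OF additive_bar_boundary_term, folded bar_boundary_eq]

lemma bar_chains_eq: "bar_chains G M n = chains {xs. length xs = n \<and> set xs \<subseteq> carrier G} M"
  by (simp add: bar_chains_def chains_def)

lemma add_subgroup_bar_chains: "add_subgroup (bar_chains G M n)"
  unfolding bar_chains_eq by (rule add_subgroup_chains[OF M])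

lemma to_bar_closed: "c \<in> Ch (Suc q) p \<Longrightarrow> to_bar c \<in> bar_chains G M q"
  unfolding Ch_def
proof (erule additive_extension_closed[OF additive_bar_term add_subgroup_bar_chains])
  fix \<sigma> m assume "\<sigma> \<in> {(hs, ts) \<in> prods. length hs = Suc q \<and> length ts = p}" and m: "m \<in> M"
  then obtain hs ts where \<sigma>: "\<sigma> = (hs, ts)" "set hs \<subseteq> carrier G" "length hs = Suc q"
    by (auto simp: prods_def)
  then have hs: "hs \<noteq> []" by auto
  then have "hd hs \<in> carrier G" using \<sigma>(2) hd_in_set by blast
  then have "Poly_Mapping.single (inhom hs) (act m (hd hs)) \<in> bar_chains G M q"
    unfolding bar_chains_eq using \<sigma> m set_inhom[OF \<sigma>(2)]
    by (intro single_in_chains[OF M]) (auto intro: act_closed)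
  then show "bar_term \<sigma> m \<in> bar_chains G M q" using hs by (simp add: \<sigma>(1))
qed

lemma of_bar_closed: "z \<in> bar_chains G M q \<Longrightarrow> of_bar z \<in> Ch (Suc q) 0"
  unfolding bar_chains_eq
  by (erule additive_extension_closed[OF additive_lift_term add_subgroup_Ch])
     (simp add: lift_term_def single_Ch set_path_from)

lemma to_bar_R: "r \<in> R \<Longrightarrow> to_bar r = 0"
proof -
  assume "r \<in> R"
  then have "to_bar r \<in> {0}"
  proof (rule additive_extension_rel[OF additive_bar_term, rotated])
    fix m g \<sigma> assume m: "m \<in> M" and "(g, \<sigma>) \<in> carrier G \<times> prods"
    then obtain hs ts where \<sigma>: "\<sigma> = (hs, ts)" "set hs \<subseteq> carrier G" "g \<in> carrier G"
      by (auto simp: prods_def)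
    show "bar_term \<sigma> (act m g) - bar_term (pact g \<sigma>) m \<in> {0}"
      using \<sigma> m subsetD[OF \<sigma>(2) hd_in_set]
      by (cases "hs = []") (simp_all add: inhom_mult hd_map act_mult)
  qed (simp add: add_subgroup_def)
  then show ?thesis by simp
qed

lemma to_bar_of_bar: "z \<in> bar_chains G M q \<Longrightarrow> to_bar (of_bar z) = z"
  unfolding bar_chains_eq
  by (erule additive_eq_on_chains[OF additive_comp[OF additive_bar(1,2)] additive_id])
     (auto simp: bar_single lift_term_def inhom_path_from act_one)

text \<open>Together with \<open>to_bar_of_bar\<close> and \<open>to_bar_R\<close>, the two maps are
  inverse on coinvariants. No germ vertices are allowed because \<open>to_bar\<close> forgets
  them.\<close>

lemma of_bar_to_bar: "c \<in> Ch (Suc q) 0 \<Longrightarrow> c - of_bar (to_bar c) \<in> R"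
  unfolding Ch_def
proof (erule additive_closed_on_chains[of "\<lambda>c. c - of_bar (to_bar c)", OF _ add_subgroup_rel, rotated])
  fix \<sigma> m assume "\<sigma> \<in> {(hs, ts) \<in> prods. length hs = Suc q \<and> length ts = 0}" and m: "m \<in> M"
  then obtain h hs where \<sigma>: "\<sigma> = (h # hs, [])" "set (h # hs) \<subseteq> carrier G"
    by (auto simp: prods_def length_Suc_conv)
  define xs where "xs = inhom (h # hs)"
  have xs: "set xs \<subseteq> carrier G" using set_inhom[OF \<sigma>(2)] by (simp add: xs_def)
  have "map ((\<otimes>) h) (path_from \<one> xs) = h # hs"
    using path_from_inhom[OF \<sigma>(2)] path_from_mult[of h \<one> xs] \<sigma>(2) xs by (simp add: xs_def)
  then have "Poly_Mapping.single (path_from \<one> xs, []) (act m h) - Poly_Mapping.single \<sigma> m \<in> R"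
    using rel_generator'[of m h "path_from \<one> xs" "[]"] m \<sigma> set_path_from[OF one_closed xs] by simp
  then have "- (Poly_Mapping.single (path_from \<one> xs, []) (act m h) - Poly_Mapping.single \<sigma> m) \<in> R"
    by (rule add_subgroup_uminus[OF add_subgroup_rel])
  then show "Poly_Mapping.single \<sigma> m - of_bar (to_bar (Poly_Mapping.single \<sigma> m)) \<in> R"
    by (simp add: bar_single \<sigma>(1) lift_term_def xs_def)
qed (use additive.add[OF additive_bar(1)] additive.add[OF additive_bar(2)] in
      \<open>simp add: Modules.additive_def\<close>)

lemma bar_boundary_to_bar:
  "c \<in> Ch (Suc (Suc q)) p \<Longrightarrow> bar_boundary G act (to_bar c) = to_bar (dG c)"
  unfolding Ch_def
proof (erule additive_eq_on_chains[OF additive_comp[OF additive_bar(3,1)]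
      additive_comp[OF additive_bar(1) additive_ops(1)]])
  fix \<sigma> m assume "\<sigma> \<in> {(hs, ts) \<in> prods. length hs = Suc (Suc q) \<and> length ts = p}" and m: "m \<in> M"
  then obtain h h' r ts where \<sigma>: "\<sigma> = (h # h' # r, ts)" "set (h # h' # r) \<subseteq> carrier G"
    by (auto simp: prods_def length_Suc_conv)
  define hs where "hs = h # h' # r"
  have \<sigma>_hs: "\<sigma> = (hs, ts)" by (simp add: \<sigma>(1) hs_def)
  have carr: "h \<in> carrier G" "h' \<in> carrier G" using \<sigma>(2) by auto
  define face where "face i = take i hs @ drop (Suc i) hs" for i
  \<comment> \<open>The new first vertex is \<open>h' = h \<otimes> (inv h \<otimes> h')\<close>, so
    the coefficient \<open>act m h\<close> is acted on by the head of \<open>inhom hs\<close>, as in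
    the first term of the bar boundary.\<close>
  have face_0: "bar_term (face 0, ts) m
      = Poly_Mapping.single (bar_face G 0 (inhom hs)) (act (act m h) (hd (inhom hs)))"
    using m carr by (simp add: face_def hs_def bar_face_def act_mult[symmetric] m_assoc[symmetric])
  have face_Suc: "(if even i then bar_term (face i, ts) m else - bar_term (face i, ts) m)
      = Poly_Mapping.single (bar_face G i (inhom hs)) (if even i then act m h else - act m h)"
    if "i \<in> {1..length r + 1}" for i
  proof -
    have "i \<noteq> 0" using that by auto
    then obtain j where "i = Suc j" using not0_implies_Suc by blast
    moreover have "hd (face (Suc j)) = h" "face (Suc j) \<noteq> []" by (simp_all add: face_def hs_def)
    moreover have "bar_face G (Suc j) (inhom hs) = inhom (face (Suc j))"
      unfolding face_def by (rule bar_face_inhom) (use that \<sigma>(2) \<open>i = Suc j\<close> in \<open>simp_all add: hs_def\<close>)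
    ultimately show ?thesis by (simp add: single_uminus)
  qed
  have range_split: "{..<Suc (Suc (length r))} = insert 0 {1..length r + 1}" by auto
  have "to_bar (dG (Poly_Mapping.single \<sigma> m)) = alt_faces (\<lambda>ys. bar_term (ys, ts) m) hs"
    by (simp add: ext_single \<sigma>_hs additive_alt_faces[OF additive_bar(1)] bar_single
        del: bar_term.simps)
  also have "\<dots> = (\<Sum>i<length hs. if even i then bar_term (face i, ts) m else - bar_term (face i, ts) m)"
    by (simp only: alt_faces_eq_sum face_def)
  also have "\<dots> = bar_term (face 0, ts) m + (\<Sum>i = 1..length r + 1.
      if even i then bar_term (face i, ts) m else - bar_term (face i, ts) m)"
    by (simp add: hs_def range_split del: bar_term.simps)
  also have "\<dots> = bar_boundary_term G act (act m h) (inhom hs)"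
    unfolding face_0 bar_boundary_term_def
    by (simp add: face_Suc del: bar_term.simps) (simp add: hs_def)
  also have "\<dots> = bar_boundary G act (to_bar (Poly_Mapping.single \<sigma> m))"
    by (simp add: bar_single \<sigma>(1) hs_def del: inhom.simps)
  finally show "bar_boundary G act (to_bar (Poly_Mapping.single \<sigma> m))
      = to_bar (dG (Poly_Mapping.single \<sigma> m))" by simp
qed

theorem bar_cycles_subset_boundaries: "bar_cycles G M act n \<subseteq> bar_boundaries G M act n"
proof
  fix z assume "z \<in> bar_cycles G M act n"
  then have z: "z \<in> bar_chains G M n" "bar_boundary G act z = 0" by (auto simp: bar_cycles_def)
  define c where "c = of_bar z"
  have c: "c \<in> Ch (Suc n) 0" and zc: "to_bar c = z"
    using z(1) by (simp_all add: c_def of_bar_closed to_bar_of_bar)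
  \<comment> \<open>For \<open>n = 0\<close> the bar boundary says nothing, whereas
    \<open>dG c\<close> is the augmentation of \<open>c\<close>; that it is a relation comes from
    the degree-zero vanishing.\<close>
  have "dG c \<in> R"
  proof (cases n)
    case 0
    then show ?thesis using dG_Ch[OF c] Ch_0_R by blast
  next
    case (Suc q)
    have "to_bar (dG c) = 0" using bar_boundary_to_bar c z(2) zc Suc by metis
    moreover have "dG c \<in> Ch (Suc q) 0" using dG_Ch c Suc by blast
    ultimately show ?thesis using of_bar_to_bar[of "dG c" q] additive.zero[OF additive_bar(2)] by simp
  qed
  moreover have "dS c = 0"
    using c unfolding Ch_def
    by (rule additive_eq_on_chains[OF additive_ops(2) additive_zero]) (auto simp: ext_single)
  then have "dS c \<in> R" by (simp add: rel.zero)
  ultimately obtain e where e: "e \<in> Ch (Suc (Suc n)) 0" "c - dG e \<in> R"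
    using double_complex_filling[OF c] by blast
  have "z = to_bar (dG e)"
    using to_bar_R[OF e(2)] zc by (simp add: additive.diff[OF additive_bar(1)])
  also have "\<dots> = bar_boundary G act (to_bar e)" using bar_boundary_to_bar[OF e(1)] by simp
  finally show "z \<in> bar_boundaries G M act n"
    using to_bar_closed[OF e(1)] by (simp add: bar_boundaries_def)
qed

text \<open>That the bar boundary squares to zero is inherited from \<open>dG\<close> through the
  surjection \<open>to_bar\<close>.\<close>

lemma bar_boundaries_subset_cycles: "bar_boundaries G M act n \<subseteq> bar_cycles G M act n"
proof
  fix z assume "z \<in> bar_boundaries G M act n"
  then obtain y where y: "y \<in> bar_chains G M (Suc n)" "z = bar_boundary G act y"
    by (auto simp: bar_boundaries_def)
  define c where "c = of_bar y"
  have c: "c \<in> Ch (Suc (Suc n)) 0" "to_bar c = y"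
    using y(1) by (simp_all add: c_def of_bar_closed to_bar_of_bar)
  have z: "z = to_bar (dG c)" using bar_boundary_to_bar[OF c(1)] c(2) y(2) by simp
  have dc: "dG c \<in> Ch (Suc n) 0" by (rule dG_Ch[OF c(1)])
  have "bar_boundary G act z = 0"
  proof (cases n)
    case 0
    have "z \<in> bar_chains G M 0" using to_bar_closed[OF dc] z 0 by simp
    then show ?thesis
      unfolding bar_chains_eq
      by (rule additive_eq_on_chains[OF additive_bar(3) additive_zero])
         (auto simp: bar_single bar_boundary_term_def)
  next
    case (Suc q)
    then show ?thesis
      using bar_boundary_to_bar[of "dG c" q 0] dc dG_dG[OF c(1)] z
      by (simp add: additive.zero[OF additive_bar(1)])
  qed
  then show "z \<in> bar_cycles G M act n"
    using to_bar_closed[OF dc] z by (simp add: bar_cycles_def)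
qed

theorem group_homology_trivial: "trivial_group (group_homology G M act n)"
proof -
  define Z :: "('a list \<Rightarrow>\<^sub>0 'm) monoid"
    where "Z = \<lparr>carrier = bar_cycles G M act n, monoid.mult = (+), one = 0\<rparr>"
  have eq: "bar_boundaries G M act n = carrier Z"
    using bar_cycles_subset_boundaries bar_boundaries_subset_cycles by (auto simp: Z_def)
  have sub: "add_subgroup (bar_cycles G M act n)"
    using add_subgroup_bar_chains[of n]
    by (auto simp: add_subgroup_def bar_cycles_def additive.diff[OF additive_bar(3)]
        additive.zero[OF additive_bar(3)])
  interpret Z: group Z
  proof (rule groupI)
    fix x assume "x \<in> carrier Z"
    then show "\<exists>y\<in>carrier Z. y \<otimes>\<^bsub>Z\<^esub> x = \<one>\<^bsub>Z\<^esub>"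
      using add_subgroup_uminus[OF sub] by (intro bexI[of _ "- x"]) (auto simp: Z_def)
  qed (use add_subgroup_add[OF sub] add_subgroup_zero[OF sub] in \<open>auto simp: Z_def add.assoc\<close>)
  have "normal (carrier Z) Z"
    by (simp add: Z.normal_inv_iff Z.subgroup_self)
  then have "group (Z Mod carrier Z)" by (rule normal.factorgroup_is_group)
  moreover have "carrier (Z Mod carrier Z) = {\<one>\<^bsub>Z Mod carrier Z\<^esub>}"
  proof -
    have "carrier Z #>\<^bsub>Z\<^esub> z = carrier Z" if "z \<in> carrier Z" for z
      by (rule Z.coset_join2[OF that Z.subgroup_self that])
    then have "rcosets\<^bsub>Z\<^esub> carrier Z = {carrier Z}"
      unfolding RCOSETS_def using Z.one_closed by blast
    then show ?thesis by (simp add: FactGroup_def)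
  qed
  moreover have "group_homology G M act n = Z Mod carrier Z"
    unfolding group_homology_def eq Z_def ..
  ultimately show ?thesis by (simp only: trivial_group_def)
qed

end

section \<open>Square-summable functions\<close>

lemma fun_sum_apply: "(\<Sum>i\<in>I. f i) x = (\<Sum>i\<in>I. f i x)"
  by (induction I rule: infinite_finite_induct) auto

text \<open>Membership and norm bounds are both tested on finite subsets, where Minkowski's
  inequality for \<open>L2_set\<close> and pointwise limits are available.\<close>

lemma l2_spaceI:
  assumes "\<And>x. x \<notin> carrier G \<Longrightarrow> f x = 0"
    and "\<And>F. finite F \<Longrightarrow> F \<subseteq> carrier G \<Longrightarrow> L2_set (\<lambda>x. cmod (f x)) F \<le> C"
  shows "f \<in> l2_space G"
proof -
  have "(\<lambda>x. (cmod (f x))\<^sup>2) summable_on carrier G"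
  proof (rule nonneg_bdd_above_summable_on)
    have "(\<Sum>x\<in>F. (cmod (f x))\<^sup>2) \<le> C\<^sup>2" if "finite F" "F \<subseteq> carrier G" for F
    proof -
      have "(L2_set (\<lambda>x. cmod (f x)) F)\<^sup>2 \<le> C\<^sup>2"
        using assms(2)[OF that] by (intro power_mono) auto
      then show ?thesis by (simp add: L2_set_def sum_nonneg)
    qed
    then show "bdd_above (sum (\<lambda>x. (cmod (f x))\<^sup>2) ` {F. F \<subseteq> carrier G \<and> finite F})"
      by (intro bdd_aboveI2[of _ _ "C\<^sup>2"]) auto
  qed auto
  with assms(1) show ?thesis by (simp add: l2_space_def)
qed

lemma l2_norm_nonneg [simp]: "0 \<le> l2_norm G f"
  by (simp add: l2_norm_def infsum_nonneg)

lemma l2_norm_squared: "(l2_norm G f)\<^sup>2 = (\<Sum>\<^sub>\<infinity>x\<in>carrier G. (cmod (f x))\<^sup>2)"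
  by (simp add: l2_norm_def infsum_nonneg)

lemma l2_space_outside: "f \<in> l2_space G \<Longrightarrow> x \<notin> carrier G \<Longrightarrow> f x = 0"
  by (simp add: l2_space_def)

lemma L2_set_le_l2_norm:
  assumes "f \<in> l2_space G" "finite F" "F \<subseteq> carrier G"
  shows "L2_set (\<lambda>x. cmod (f x)) F \<le> l2_norm G f"
  unfolding L2_set_def l2_norm_def
  using assms by (intro real_sqrt_le_mono finite_sum_le_infsum) (auto simp: l2_space_def)

lemma l2_norm_le:
  assumes "f \<in> l2_space G"
    and "\<And>F. finite F \<Longrightarrow> F \<subseteq> carrier G \<Longrightarrow> L2_set (\<lambda>x. cmod (f x)) F \<le> C"
  shows "l2_norm G f \<le> C"
proof -
  have C: "0 \<le> C" using assms(2)[of "{}"] by simp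
  have "(\<Sum>\<^sub>\<infinity>x\<in>carrier G. (cmod (f x))\<^sup>2) \<le> C\<^sup>2"
  proof (rule infsum_le_finite_sums)
    fix F assume "finite F" "F \<subseteq> carrier G"
    then have "(L2_set (\<lambda>x. cmod (f x)) F)\<^sup>2 \<le> C\<^sup>2"
      using assms(2) by (intro power_mono) auto
    then show "(\<Sum>x\<in>F. (cmod (f x))\<^sup>2) \<le> C\<^sup>2" by (simp add: L2_set_def sum_nonneg)
  qed (use assms(1) in \<open>simp add: l2_space_def\<close>)
  then show ?thesis unfolding l2_norm_def using C by (simp add: real_le_lsqrt infsum_nonneg)
qed

lemma cmod_le_l2_norm: "f \<in> l2_space G \<Longrightarrow> cmod (f x) \<le> l2_norm G f"
  using L2_set_le_l2_norm[of f G "{x}"] l2_space_outside[of f G x]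
  by (cases "x \<in> carrier G") (simp_all add: L2_set_def)

lemma l2_space_dominated:
  assumes "f \<in> l2_space G" "\<And>x. x \<notin> carrier G \<Longrightarrow> g x = 0"
    and "\<And>x. x \<in> carrier G \<Longrightarrow> cmod (g x) \<le> cmod (f x)"
  shows "g \<in> l2_space G" "l2_norm G g \<le> l2_norm G f"
proof -
  have *: "L2_set (\<lambda>x. cmod (g x)) F \<le> l2_norm G f" if "finite F" "F \<subseteq> carrier G" for F
  proof -
    have "L2_set (\<lambda>x. cmod (g x)) F \<le> L2_set (\<lambda>x. cmod (f x)) F"
      by (rule L2_set_mono) (use assms(3) that in auto)
    also have "\<dots> \<le> l2_norm G f" by (rule L2_set_le_l2_norm[OF assms(1) that])
    finally show ?thesis .
  qed
  show "g \<in> l2_space G" by (rule l2_spaceI[OF assms(2) *])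
  then show "l2_norm G g \<le> l2_norm G f" by (rule l2_norm_le[OF _ *])
qed

lemma l2_space_zero [simp]: "0 \<in> l2_space G"
  by (simp add: l2_space_def)

lemma l2_norm_zero [simp]: "l2_norm G 0 = 0"
  by (simp add: l2_norm_def)

lemma
  assumes f: "f \<in> l2_space G" and g: "g \<in> l2_space G"
  shows l2_space_add: "f + g \<in> l2_space G"
    and l2_norm_triangle: "l2_norm G (f + g) \<le> l2_norm G f + l2_norm G g"
proof -
  have *: "L2_set (\<lambda>x. cmod ((f + g) x)) F \<le> l2_norm G f + l2_norm G g"
    if "finite F" "F \<subseteq> carrier G" for F
  proof -
    have "L2_set (\<lambda>x. cmod ((f + g) x)) F \<le> L2_set (\<lambda>x. cmod (f x) + cmod (g x)) F"
      by (intro L2_set_mono) (auto simp: norm_triangle_ineq)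
    also have "\<dots> \<le> L2_set (\<lambda>x. cmod (f x)) F + L2_set (\<lambda>x. cmod (g x)) F"
      by (rule L2_set_triangle_ineq)
    also have "\<dots> \<le> l2_norm G f + l2_norm G g"
      by (intro add_mono L2_set_le_l2_norm f g that)
    finally show ?thesis .
  qed
  show "f + g \<in> l2_space G"
    by (rule l2_spaceI[OF _ *]) (simp add: l2_space_outside[OF f] l2_space_outside[OF g])
  then show "l2_norm G (f + g) \<le> l2_norm G f + l2_norm G g" by (rule l2_norm_le[OF _ *])
qed

lemma l2_norm_scale: "l2_norm G (\<lambda>x. c * f x) = cmod c * l2_norm G f"
proof -
  have "(l2_norm G (\<lambda>x. c * f x))\<^sup>2 = (cmod c * l2_norm G f)\<^sup>2"
    by (simp add: l2_norm_squared norm_mult power_mult_distrib infsum_cmult_right')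
  then show ?thesis by (simp add: power2_eq_iff_nonneg)
qed

lemma l2_space_scale: "f \<in> l2_space G \<Longrightarrow> (\<lambda>x. c * f x) \<in> l2_space G"
  by (auto simp: l2_space_def norm_mult power_mult_distrib intro: summable_on_cmult_right)

lemma l2_norm_uminus [simp]: "l2_norm G (- f) = l2_norm G f"
  by (simp add: l2_norm_def)

lemma l2_space_uminus: "f \<in> l2_space G \<Longrightarrow> - f \<in> l2_space G"
  by (auto simp: l2_space_def)

lemma l2_space_diff: "f \<in> l2_space G \<Longrightarrow> g \<in> l2_space G \<Longrightarrow> f - g \<in> l2_space G"
  using l2_space_add[OF _ l2_space_uminus, of f G g] by simp

lemma l2_norm_minus_commute: "l2_norm G (f - g) = l2_norm G (g - f)"
  by (metis l2_norm_uminus minus_diff_eq)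

lemma l2_norm_triangle_diff:
  assumes "f \<in> l2_space G" "g \<in> l2_space G"
  shows "\<bar>l2_norm G f - l2_norm G g\<bar> \<le> l2_norm G (f - g)"
  using l2_norm_triangle[OF assms(2) l2_space_diff[OF assms]]
    l2_norm_triangle[OF assms(1) l2_space_diff[OF assms(2,1)]] l2_norm_minus_commute[of G f g]
  by (auto simp: abs_le_iff)

lemma
  assumes "\<And>i. i \<in> I \<Longrightarrow> f i \<in> l2_space G"
  shows l2_space_sum: "(\<Sum>i\<in>I. f i) \<in> l2_space G"
    and l2_norm_sum: "l2_norm G (\<Sum>i\<in>I. f i) \<le> (\<Sum>i\<in>I. l2_norm G (f i))"
proof -
  have "(\<Sum>i\<in>I. f i) \<in> l2_space G \<and> l2_norm G (\<Sum>i\<in>I. f i) \<le> (\<Sum>i\<in>I. l2_norm G (f i))"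
    using assms
  proof (induction I rule: infinite_finite_induct)
    case (insert i I)
    then have "f i \<in> l2_space G" "sum f I \<in> l2_space G"
      and IH: "l2_norm G (sum f I) \<le> (\<Sum>i\<in>I. l2_norm G (f i))" by auto
    with l2_space_add[OF this(1,2)] l2_norm_triangle[OF this(1,2)] show ?case
      unfolding sum.insert[OF insert(1,2)] by linarith
  qed auto
  then show "(\<Sum>i\<in>I. f i) \<in> l2_space G" "l2_norm G (\<Sum>i\<in>I. f i) \<le> (\<Sum>i\<in>I. l2_norm G (f i))"
    by auto
qed

text \<open>Serves to convert displacement of a vector by an isometry into shortness of its sum with
  its image.\<close>

lemma l2_norm_parallelogram:
  assumes f: "f \<in> l2_space G" and g: "g \<in> l2_space G"
  shows "(l2_norm G (f + g))\<^sup>2 + (l2_norm G (f - g))\<^sup>2 = 2 * (l2_norm G f)\<^sup>2 + 2 * (l2_norm G g)\<^sup>2"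
proof -
  have s: "(\<lambda>x. (cmod (h x))\<^sup>2) summable_on carrier G" if "h \<in> l2_space G" for h
    using that by (simp add: l2_space_def)
  have "(cmod (a + b))\<^sup>2 + (cmod (a - b))\<^sup>2 = 2 * (cmod a)\<^sup>2 + 2 * (cmod b)\<^sup>2" for a b
    by (simp add: cmod_power2) (simp add: power2_eq_square algebra_simps)
  then have "(\<lambda>x. (cmod ((f + g) x))\<^sup>2 + (cmod ((f - g) x))\<^sup>2)
      = (\<lambda>x. 2 * (cmod (f x))\<^sup>2 + 2 * (cmod (g x))\<^sup>2)"
    by (simp add: fun_eq_iff)
  then have "(\<Sum>\<^sub>\<infinity>x\<in>carrier G. (cmod ((f + g) x))\<^sup>2 + (cmod ((f - g) x))\<^sup>2)
      = (\<Sum>\<^sub>\<infinity>x\<in>carrier G. 2 * (cmod (f x))\<^sup>2 + 2 * (cmod (g x))\<^sup>2)"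
    by simp
  then show ?thesis
    using s[OF f] s[OF g] s[OF l2_space_add[OF f g]] s[OF l2_space_diff[OF f g]]
    by (simp add: l2_norm_squared infsum_add infsum_cmult_right summable_on_cmult_right)
qed

section \<open>The group von Neumann algebra\<close>

context group begin

lemma l2_space_translate:
  assumes f: "f \<in> l2_space G" and \<tau>: "bij_betw \<tau> (carrier G) (carrier G)"
  shows "(\<lambda>x. if x \<in> carrier G then f (\<tau> x) else 0) \<in> l2_space G"
    and "l2_norm G (\<lambda>x. if x \<in> carrier G then f (\<tau> x) else 0) = l2_norm G f"
proof -
  have "(\<lambda>x. (cmod (if x \<in> carrier G then f (\<tau> x) else 0))\<^sup>2) summable_on carrier G \<longleftrightarrow>
      (\<lambda>x. (cmod (f (\<tau> x)))\<^sup>2) summable_on carrier G"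
    by (rule summable_on_cong) simp
  also have "\<dots>"
    using f summable_on_reindex_bij_betw[OF \<tau>, of "\<lambda>x. (cmod (f x))\<^sup>2"]
    by (simp add: l2_space_def)
  finally show "(\<lambda>x. if x \<in> carrier G then f (\<tau> x) else 0) \<in> l2_space G"
    by (simp add: l2_space_def)
  have "(\<Sum>\<^sub>\<infinity>x\<in>carrier G. (cmod (if x \<in> carrier G then f (\<tau> x) else 0))\<^sup>2)
      = (\<Sum>\<^sub>\<infinity>x\<in>carrier G. (cmod (f (\<tau> x)))\<^sup>2)"
    by (rule infsum_cong) simp
  also have "\<dots> = (\<Sum>\<^sub>\<infinity>x\<in>carrier G. (cmod (f x))\<^sup>2)" by (rule infsum_reindex_bij_betw[OF \<tau>])
  finally show "l2_norm G (\<lambda>x. if x \<in> carrier G then f (\<tau> x) else 0) = l2_norm G f"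
    by (simp add: l2_norm_def)
qed

lemma bij_left_mult: "g \<in> carrier G \<Longrightarrow> bij_betw (\<lambda>x. g \<otimes> x) (carrier G) (carrier G)"
  by (rule bij_betwI[where g = "\<lambda>x. inv g \<otimes> x"]) (auto simp: m_assoc[symmetric])

lemma bij_right_mult: "g \<in> carrier G \<Longrightarrow> bij_betw (\<lambda>x. x \<otimes> g) (carrier G) (carrier G)"
  by (rule bij_betwI[where g = "\<lambda>x. x \<otimes> inv g"]) (auto simp: m_assoc)

lemma right_regular_l2:
  assumes "f \<in> l2_space G" "g \<in> carrier G"
  shows "right_regular G g f \<in> l2_space G" "l2_norm G (right_regular G g f) = l2_norm G f"
  using l2_space_translate[OF assms(1) bij_right_mult[OF assms(2)]] assms(1)
  by (simp_all add: right_regular_def)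

lemma left_regular_l2:
  assumes "f \<in> l2_space G" "g \<in> carrier G"
  shows "left_regular G g f \<in> l2_space G" "l2_norm G (left_regular G g f) = l2_norm G f"
  using l2_space_translate[OF assms(1) bij_left_mult[OF inv_closed[OF assms(2)]]] assms(1)
  by (simp_all add: left_regular_def)

lemma right_regular_apply:
  "f \<in> l2_space G \<Longrightarrow> x \<in> carrier G \<Longrightarrow> right_regular G g f x = f (x \<otimes> g)"
  by (simp add: right_regular_def)

lemma right_regular_one: "f \<in> l2_space G \<Longrightarrow> right_regular G \<one> f = f"
  by (auto simp: right_regular_def fun_eq_iff l2_space_outside)

lemma regular_zero [simp]: "right_regular G g 0 = 0" "left_regular G g 0 = 0"
  by (auto simp: right_regular_def left_regular_def fun_eq_iff)

lemma right_regular_mult: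
  assumes "g \<in> carrier G" "h \<in> carrier G"
  shows "right_regular G (g \<otimes> h) = right_regular G g \<circ> right_regular G h"
proof
  fix f
  show "right_regular G (g \<otimes> h) f = (right_regular G g \<circ> right_regular G h) f"
  proof (cases "f \<in> l2_space G")
    case True
    with right_regular_l2[OF True assms(2)] assms show ?thesis
      by (auto simp: fun_eq_iff right_regular_def m_assoc)
  qed (simp add: right_regular_def fun_eq_iff)
qed

lemma bounded_operators_zero:
  assumes "T \<in> bounded_operators G"
  shows "T 0 = 0"
proof -
  have "\<forall>f\<in>l2_space G. \<forall>h\<in>l2_space G. T (f + h) = T f + T h"
    using assms by (simp add: bounded_operators_def)
  then have "T (0 + 0) = T 0 + T 0" using l2_space_zero by blast
  then show ?thesis by simp
qed

text \<open>Equality of the composed functions need only be tested on square-summable arguments,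
  since both sides vanish on all others.\<close>

lemma group_vN_iff:
  "T \<in> group_vN G \<longleftrightarrow>
     (\<forall>f. f \<notin> l2_space G \<longrightarrow> T f = 0) \<and> (\<forall>f \<in> l2_space G. T f \<in> l2_space G) \<and>
     (\<forall>f \<in> l2_space G. \<forall>h \<in> l2_space G. T (f + h) = T f + T h) \<and>
     (\<forall>c. \<forall>f \<in> l2_space G. T (\<lambda>x. c * f x) = (\<lambda>x. c * T f x)) \<and>
     (\<exists>C. \<forall>f \<in> l2_space G. l2_norm G (T f) \<le> C * l2_norm G f) \<and>
     (\<forall>g \<in> carrier G. \<forall>f \<in> l2_space G. T (left_regular G g f) = left_regular G g (T f))"
proof -
  have "T \<circ> left_regular G g = left_regular G g \<circ> T \<longleftrightarrow>
      (\<forall>f \<in> l2_space G. T (left_regular G g f) = left_regular G g (T f))"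
    if T: "T \<in> bounded_operators G" for g
  proof -
    have "T (left_regular G g f) = left_regular G g (T f)" if "f \<notin> l2_space G" for f
    proof -
      have "left_regular G g f = 0" "T f = 0"
        using T that by (auto simp: left_regular_def bounded_operators_def)
      then show ?thesis by (simp add: bounded_operators_zero[OF T])
    qed
    then show ?thesis by (metis comp_apply ext)
  qed
  then have "T \<in> group_vN G \<longleftrightarrow> T \<in> bounded_operators G \<and>
      (\<forall>g \<in> carrier G. \<forall>f \<in> l2_space G. T (left_regular G g f) = left_regular G g (T f))"
    unfolding group_vN_def by blast
  then show ?thesis
    unfolding bounded_operators_def mem_Collect_eq conj_assoc .
qed

lemma group_vNI:
  assumes "\<And>f. f \<notin> l2_space G \<Longrightarrow> T f = 0" "\<And>f. f \<in> l2_space G \<Longrightarrow> T f \<in> l2_space G"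
    and "\<And>f h. f \<in> l2_space G \<Longrightarrow> h \<in> l2_space G \<Longrightarrow> T (f + h) = T f + T h"
    and "\<And>c f. f \<in> l2_space G \<Longrightarrow> T (\<lambda>x. c * f x) = (\<lambda>x. c * T f x)"
    and "\<And>f. f \<in> l2_space G \<Longrightarrow> l2_norm G (T f) \<le> C * l2_norm G f"
    and "\<And>g f. g \<in> carrier G \<Longrightarrow> f \<in> l2_space G \<Longrightarrow> T (left_regular G g f) = left_regular G g (T f)"
  shows "T \<in> group_vN G"
  unfolding group_vN_iff using assms by blast

lemma
  assumes "T \<in> group_vN G"
  shows vN_outside: "f \<notin> l2_space G \<Longrightarrow> T f = 0"
    and vN_l2: "f \<in> l2_space G \<Longrightarrow> T f \<in> l2_space G"
    and vN_add: "f \<in> l2_space G \<Longrightarrow> h \<in> l2_space G \<Longrightarrow> T (f + h) = T f + T h"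
    and vN_scale: "f \<in> l2_space G \<Longrightarrow> T (\<lambda>x. c * f x) = (\<lambda>x. c * T f x)"
    and vN_bound: "\<exists>C\<ge>0. \<forall>f \<in> l2_space G. l2_norm G (T f) \<le> C * l2_norm G f"
    and vN_left: "g \<in> carrier G \<Longrightarrow> f \<in> l2_space G \<Longrightarrow> T (left_regular G g f) = left_regular G g (T f)"
    and vN_zero: "T 0 = 0"
proof -
  note T = assms[unfolded group_vN_iff]
  obtain C where C: "l2_norm G (T f) \<le> C * l2_norm G f" if "f \<in> l2_space G" for f
    using T by blast
  have "l2_norm G (T f) \<le> max C 0 * l2_norm G f" if "f \<in> l2_space G" for f
    using C[OF that] mult_right_mono[of C "max C 0" "l2_norm G f"] by simp
  then show "\<exists>C\<ge>0. \<forall>f \<in> l2_space G. l2_norm G (T f) \<le> C * l2_norm G f"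
    by (intro exI[of _ "max C 0"]) auto
  show "T 0 = 0" using assms bounded_operators_zero by (auto simp: group_vN_def)
qed (use assms[unfolded group_vN_iff] in auto)

lemma vN_diff:
  assumes "T \<in> group_vN G" "f \<in> l2_space G" "h \<in> l2_space G"
  shows "T (f - h) = T f - T h"
proof -
  have "T (f - h) + T h = T f"
    using vN_add[OF assms(1) l2_space_diff[OF assms(2,3)] assms(3)] by simp
  then show ?thesis by (metis add_diff_cancel_right')
qed

lemma vN_sum:
  assumes T: "T \<in> group_vN G" and f: "\<And>i. i \<in> I \<Longrightarrow> f i \<in> l2_space G"
  shows "T (\<Sum>i\<in>I. f i) = (\<Sum>i\<in>I. T (f i))"
  using f
proof (induction I rule: infinite_finite_induct)
  case (insert i I)
  then have "f i \<in> l2_space G" "sum f I \<in> l2_space G" by (auto intro: l2_space_sum)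
  from vN_add[OF T this] have "T (f i + sum f I) = T (f i) + (\<Sum>i\<in>I. T (f i))"
    using insert.IH insert.prems by simp
  then show ?case by (simp only: sum.insert[OF insert(1,2)])
qed (simp_all add: vN_zero[OF T])

lemma left_regular_add:
  "f \<in> l2_space G \<Longrightarrow> h \<in> l2_space G \<Longrightarrow>
    left_regular G g (f + h) = left_regular G g f + left_regular G g h"
  by (auto simp: left_regular_def l2_space_add fun_eq_iff)

lemma left_regular_scale:
  "f \<in> l2_space G \<Longrightarrow> left_regular G g (\<lambda>x. c * f x) = (\<lambda>x. c * left_regular G g f x)"
  by (auto simp: left_regular_def l2_space_scale fun_eq_iff)

lemma vN_zero_mem: "0 \<in> group_vN G"
  by (rule group_vNI[of _ 0]) (auto simp: fun_eq_iff)

lemma vN_add_mem: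
  assumes T: "T \<in> group_vN G" and U: "U \<in> group_vN G"
  shows "T + U \<in> group_vN G"
proof -
  obtain C D where C: "\<forall>f \<in> l2_space G. l2_norm G (T f) \<le> C * l2_norm G f"
    and D: "\<forall>f \<in> l2_space G. l2_norm G (U f) \<le> D * l2_norm G f"
    using vN_bound[OF T] vN_bound[OF U] by blast
  show ?thesis
  proof (rule group_vNI[where C = "C + D"])
    fix f assume f: "f \<in> l2_space G"
    show "l2_norm G ((T + U) f) \<le> (C + D) * l2_norm G f"
      using l2_norm_triangle[OF vN_l2[OF T f] vN_l2[OF U f]] bspec[OF C f] bspec[OF D f]
      by (simp add: algebra_simps)
  qed (simp_all add: vN_outside[OF T] vN_outside[OF U] vN_l2[OF T] vN_l2[OF U] vN_add[OF T]
      vN_add[OF U] vN_scale[OF T] vN_scale[OF U] vN_left[OF T] vN_left[OF U] l2_space_add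
      left_regular_add algebra_simps fun_eq_iff)
qed

lemma vN_scale_mem:
  assumes T: "T \<in> group_vN G"
  shows "(\<lambda>f x. c * T f x) \<in> group_vN G"
proof -
  obtain C where C: "\<forall>f \<in> l2_space G. l2_norm G (T f) \<le> C * l2_norm G f"
    using vN_bound[OF T] by blast
  show ?thesis
  proof (rule group_vNI[where C = "cmod c * C"])
    fix f assume f: "f \<in> l2_space G"
    show "l2_norm G (\<lambda>x. c * T f x) \<le> (cmod c * C) * l2_norm G f"
      using mult_left_mono[OF bspec[OF C f], of "cmod c"] by (simp add: l2_norm_scale mult.assoc)
  qed (simp_all add: vN_outside[OF T] vN_l2[OF T] vN_add[OF T] vN_scale[OF T] vN_left[OF T]
        l2_space_scale left_regular_scale algebra_simps fun_eq_iff)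
qed

lemma vN_uminus_mem: "T \<in> group_vN G \<Longrightarrow> - T \<in> group_vN G"
  using vN_scale_mem[of T "-1"] by (simp add: fun_Compl_def)

lemma vN_sum_mem: "(\<And>i. i \<in> I \<Longrightarrow> T i \<in> group_vN G) \<Longrightarrow> (\<Sum>i\<in>I. T i) \<in> group_vN G"
  by (induction I rule: infinite_finite_induct) (auto intro: vN_zero_mem vN_add_mem)

lemma vN_comp_mem:
  assumes T: "T \<in> group_vN G" and U: "U \<in> group_vN G"
  shows "T \<circ> U \<in> group_vN G"
proof -
  obtain C D where C: "0 \<le> C" "\<forall>f \<in> l2_space G. l2_norm G (T f) \<le> C * l2_norm G f"
    and D: "\<forall>f \<in> l2_space G. l2_norm G (U f) \<le> D * l2_norm G f"
    using vN_bound[OF T] vN_bound[OF U] by blast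
  have "l2_norm G (T (U f)) \<le> (C * D) * l2_norm G f" if f: "f \<in> l2_space G" for f
    using bspec[OF C(2) vN_l2[OF U f]] mult_left_mono[OF bspec[OF D f] C(1)] by (simp add: mult.assoc)
  then show ?thesis
    unfolding group_vN_iff
    by (auto simp: vN_outside[OF U] vN_l2[OF T] vN_l2[OF U] vN_add[OF T] vN_add[OF U]
        vN_scale[OF T] vN_scale[OF U] vN_left[OF T] vN_left[OF U] vN_zero[OF T])
qed

lemma right_regular_mem:
  assumes g: "g \<in> carrier G"
  shows "right_regular G g \<in> group_vN G"
proof -
  have "right_regular G g (left_regular G h f) = left_regular G h (right_regular G g f)"
    if "h \<in> carrier G" "f \<in> l2_space G" for h f
    using that g right_regular_l2[OF that(2) g] left_regular_l2[OF that(2,1)]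
    by (auto simp: right_regular_def left_regular_def fun_eq_iff m_assoc)
  moreover have "\<exists>C. \<forall>f \<in> l2_space G. l2_norm G (right_regular G g f) \<le> C * l2_norm G f"
    using right_regular_l2(2)[OF _ g] by (intro exI[of _ 1]) auto
  ultimately show ?thesis
    unfolding group_vN_iff
    using right_regular_l2(1)[OF _ g]
    by (auto simp: right_regular_def fun_eq_iff l2_space_add l2_space_scale)
qed


lemma right_regular_vN_commute:
  assumes T: "T \<in> group_vN G" and h: "h \<in> carrier G"
    and comm: "\<And>f. f \<in> l2_space G \<Longrightarrow> T (right_regular G h f) = right_regular G h (T f)"
  shows "T \<circ> right_regular G h = right_regular G h \<circ> T"
proof
  fix f
  show "(T \<circ> right_regular G h) f = (right_regular G h \<circ> T) f"
  proof (cases "f \<in> l2_space G")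
    case False
    then have "right_regular G h f = 0" "T f = 0"
      by (auto simp: right_regular_def vN_outside[OF T])
    then show ?thesis by (simp add: vN_zero[OF T])
  qed (simp add: comm)
qed

section \<open>Inverting a small perturbation of the identity\<close>

text \<open>The Neumann series for the inverse of \<open>1 - P\<close>, summed at each point;
  pointwise sums with uniform bounds on finite sets replace convergence in norm.\<close>

definition neumann :: "'a operator \<Rightarrow> 'a operator" where
  "neumann P f = (if f \<in> l2_space G then (\<lambda>x. suminf (\<lambda>j. (P ^^ j) f x)) else 0)"

context
  fixes P :: "'a operator" and q :: real
  assumes P: "P \<in> group_vN G" and q: "0 \<le> q" "q < 1"
    and contraction: "\<And>f. f \<in> l2_space G \<Longrightarrow> l2_norm G (P f) \<le> q * l2_norm G f"
begin

lemma power_l2: "f \<in> l2_space G \<Longrightarrow> (P ^^ j) f \<in> l2_space G"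
  by (induction j) (auto intro: vN_l2[OF P])

lemma power_bound: "f \<in> l2_space G \<Longrightarrow> l2_norm G ((P ^^ j) f) \<le> q ^ j * l2_norm G f"
proof (induction j)
  case (Suc j)
  have "l2_norm G ((P ^^ Suc j) f) \<le> q * l2_norm G ((P ^^ j) f)"
    using contraction[OF power_l2[OF Suc.prems]] by simp
  also have "\<dots> \<le> q * (q ^ j * l2_norm G f)" using Suc q by (intro mult_left_mono) auto
  finally show ?case by (simp add: mult.assoc)
qed simp

lemma power_summable: "f \<in> l2_space G \<Longrightarrow> summable (\<lambda>j. (P ^^ j) f x)"
proof (rule summable_comparison_test)
  assume f: "f \<in> l2_space G"
  have "cmod ((P ^^ j) f x) \<le> q ^ j * l2_norm G f" for j
    using cmod_le_l2_norm[OF power_l2[OF f]] power_bound[OF f] by (rule order_trans)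
  then show "\<exists>N. \<forall>j\<ge>N. cmod ((P ^^ j) f x) \<le> q ^ j * l2_norm G f" by blast
  show "summable (\<lambda>j. q ^ j * l2_norm G f)" using q by (intro summable_mult2 summable_geometric) auto
qed

text \<open>On a finite set, the pointwise limit of the partial sums inherits their geometric
  bound.\<close>

lemma neumann_L2_set:
  assumes f: "f \<in> l2_space G" and F: "finite F" "F \<subseteq> carrier G"
  shows "L2_set (\<lambda>x. cmod (neumann P f x)) F \<le> 1 / (1 - q) * l2_norm G f"
proof (rule LIMSEQ_le_const2)
  have "(\<lambda>n. cmod (\<Sum>j<n. (P ^^ j) f x)) \<longlonglongrightarrow> cmod (neumann P f x)" for x
    using f power_summable[OF f] by (auto simp: neumann_def intro!: tendsto_norm summable_LIMSEQ)
  then show "(\<lambda>n. L2_set (\<lambda>x. cmod ((\<Sum>j<n. (P ^^ j) f) x)) F) \<longlonglongrightarrow> L2_set (\<lambda>x. cmod (neumann P f x)) F"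
    unfolding L2_set_def fun_sum_apply
    by (intro tendsto_real_sqrt tendsto_sum tendsto_power) auto
  have "L2_set (\<lambda>x. cmod ((\<Sum>j<n. (P ^^ j) f) x)) F \<le> 1 / (1 - q) * l2_norm G f" for n
  proof -
    have "L2_set (\<lambda>x. cmod ((\<Sum>j<n. (P ^^ j) f) x)) F \<le> l2_norm G (\<Sum>j<n. (P ^^ j) f)"
      by (intro L2_set_le_l2_norm l2_space_sum power_l2 f F)
    also have "\<dots> \<le> (\<Sum>j<n. l2_norm G ((P ^^ j) f))" by (intro l2_norm_sum power_l2 f)
    also have "\<dots> \<le> (\<Sum>j<n. q ^ j * l2_norm G f)" by (intro sum_mono power_bound f)
    also have "\<dots> = (\<Sum>j<n. q ^ j) * l2_norm G f" by (simp add: sum_distrib_right)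
    also have "\<dots> \<le> suminf (\<lambda>j. q ^ j) * l2_norm G f"
      using q by (intro mult_right_mono sum_le_suminf summable_geometric) auto
    finally show ?thesis using q by (simp add: suminf_geometric)
  qed
  then show "\<exists>N. \<forall>n\<ge>N. L2_set (\<lambda>x. cmod ((\<Sum>j<n. (P ^^ j) f) x)) F \<le> 1 / (1 - q) * l2_norm G f"
    by blast
qed

lemma neumann_l2:
  assumes f: "f \<in> l2_space G"
  shows "neumann P f \<in> l2_space G"
  by (rule l2_spaceI[OF _ neumann_L2_set[OF f]])
     (simp add: neumann_def f l2_space_outside[OF power_l2[OF f]])

text \<open>Translations only permute coordinates, so they pass through a pointwise series. This
  gives both equivariance on the left and commutation with centralizing elements on the
  right.\<close>

lemma neumann_translate:
  assumes f: "f \<in> l2_space G"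
    and U: "\<And>f. f \<in> l2_space G \<Longrightarrow> U f = (\<lambda>x. if x \<in> carrier G then f (\<tau> x) else 0)"
    and U_l2: "\<And>f. f \<in> l2_space G \<Longrightarrow> U f \<in> l2_space G"
    and comm: "\<And>f. f \<in> l2_space G \<Longrightarrow> P (U f) = U (P f)"
  shows "neumann P (U f) = U (neumann P f)"
proof -
  have step: "(P ^^ j) (U f) = U ((P ^^ j) f)" for j
    by (induction j) (simp_all add: comm power_l2[OF f])
  show ?thesis
  proof
    fix x
    have "neumann P (U f) x = suminf (\<lambda>j. if x \<in> carrier G then (P ^^ j) f (\<tau> x) else 0)"
      by (simp add: neumann_def U_l2 f step U[OF power_l2[OF f]])
    moreover have "U (neumann P f) x = (if x \<in> carrier G then neumann P f (\<tau> x) else 0)"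
      by (simp add: U[OF neumann_l2[OF f]])
    ultimately show "neumann P (U f) x = U (neumann P f) x" by (simp add: neumann_def f)
  qed
qed

lemma neumann_mem: "neumann P \<in> group_vN G"
proof (rule group_vNI[where C = "1 / (1 - q)"])
  fix f assume f: "f \<in> l2_space G"
  show "neumann P f \<in> l2_space G" by (rule neumann_l2[OF f])
  then show "l2_norm G (neumann P f) \<le> 1 / (1 - q) * l2_norm G f"
    by (rule l2_norm_le[OF _ neumann_L2_set[OF f]])
next
  fix f h assume f: "f \<in> l2_space G" and h: "h \<in> l2_space G"
  have "(P ^^ j) (f + h) = (P ^^ j) f + (P ^^ j) h" for j
    by (induction j)
       (simp_all only: funpow.simps comp_apply id_apply vN_add[OF P power_l2[OF f] power_l2[OF h]])
  then show "neumann P (f + h) = neumann P f + neumann P h"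
    using f h power_summable[OF f] power_summable[OF h]
    by (simp add: neumann_def l2_space_add fun_eq_iff suminf_add)
next
  fix c f assume f: "f \<in> l2_space G"
  have "(P ^^ j) (\<lambda>x. c * f x) = (\<lambda>x. c * (P ^^ j) f x)" for j
    by (induction j) (simp_all add: vN_scale[OF P] power_l2 f)
  then show "neumann P (\<lambda>x. c * f x) = (\<lambda>x. c * neumann P f x)"
    using f power_summable[OF f] by (simp add: neumann_def l2_space_scale fun_eq_iff suminf_mult)
next
  fix g f assume g: "g \<in> carrier G" and f: "f \<in> l2_space G"
  show "neumann P (left_regular G g f) = left_regular G g (neumann P f)"
    by (rule neumann_translate[OF f, where \<tau> = "\<lambda>x. inv g \<otimes> x"])
       (auto simp: left_regular_l2 g vN_left[OF P], simp add: left_regular_def)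
qed (simp add: neumann_def)

text \<open>The series telescopes at each point. Applying \<open>1 - P\<close> first is the order
  required to write \<open>T\<close> as \<open>T \<circ> a\<close> composed with a sum of
  differences.\<close>

lemma neumann_inverse: "f \<in> l2_space G \<Longrightarrow> neumann P (f - P f) = f"
proof
  fix x assume f: "f \<in> l2_space G"
  note Pf = vN_l2[OF P f]
  have "(P ^^ j) (f - P f) = (P ^^ j) f - (P ^^ Suc j) f" for j
    by (induction j) (simp_all only: funpow.simps comp_apply id_apply
        vN_diff[OF P power_l2[OF f] vN_l2[OF P power_l2[OF f]]])
  then have "neumann P (f - P f) x = suminf (\<lambda>j. (P ^^ j) f x - (P ^^ Suc j) f x)"
    using f Pf by (simp add: neumann_def l2_space_diff)
  also have "\<dots> = (P ^^ 0) f x - 0"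
    by (rule sums_unique[symmetric], rule telescope_sums', rule summable_LIMSEQ_zero, rule power_summable[OF f])
  finally show "neumann P (f - P f) x = f x" by simp
qed

end

theorem spectral_gap_splitting:
  assumes K: "finite K" "K \<subseteq> carrier G" "0 < \<epsilon>"
    and gap: "\<And>f. f \<in> l2_space G \<Longrightarrow> \<exists>k\<in>K. \<epsilon> * l2_norm G f \<le> l2_norm G (right_regular G k f - f)"
  obtains a where "a \<in> group_vN G"
    and "\<And>h. h \<in> carrier G \<Longrightarrow> (\<And>k. k \<in> K \<Longrightarrow> h \<otimes> k = k \<otimes> h) \<Longrightarrow>
           a \<circ> right_regular G h = right_regular G h \<circ> a"
    and "\<And>T. T \<in> group_vN G \<Longrightarrow> T = (\<Sum>k\<in>K. (T \<circ> a) - ((T \<circ> a) \<circ> right_regular G k))"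
proof -
  \<comment> \<open>The average runs over \<open>K\<close> and one further copy of the identity, so
    that \<open>f\<close> itself is available to be paired with the translate that is far from
    it.\<close>
  define N where "N = real (card K) + 1"
  have N: "N > 0" by (simp add: N_def)
  define c where "c = complex_of_real (1 / N)"
  have cN: "cmod c = 1 / N" "complex_of_real N * c = 1"
    using N by (simp_all add: c_def norm_divide)
  define P where "P = (\<lambda>f x. c * (right_regular G \<one> + (\<Sum>k\<in>K. right_regular G k)) f x)"
  have P: "P \<in> group_vN G"
    unfolding P_def using K by (intro vN_scale_mem vN_add_mem vN_sum_mem right_regular_mem) auto
  have P_apply: "P f = (\<lambda>x. c * (f + (\<Sum>k\<in>K. right_regular G k f)) x)" if "f \<in> l2_space G" for f
    by (simp add: P_def right_regular_one[OF that] fun_sum_apply)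
  \<comment> \<open>If \<open>k\<close> displaces \<open>f\<close> by \<open>\<epsilon>\<close>
    times its norm, the parallelogram law bounds \<open>f + right_regular G k f\<close> by
    \<open>2 * r\<close> times that norm. The other \<open>N - 2\<close> terms contribute at most
    one norm each, whence \<open>q\<close>. The maximum with 0 covers
    \<open>\<epsilon> > 2\<close>.\<close>
  define r where "r = sqrt (max 0 (1 - \<epsilon>\<^sup>2 / 4))"
  define q where "q = (N - 2 + 2 * r) / N"
  have r: "0 \<le> r" "r < 1" using K(3) by (auto simp: r_def real_sqrt_lt_1_iff)
  have r_sq: "1 - \<epsilon>\<^sup>2 / 4 \<le> r\<^sup>2" by (simp add: r_def)
  have "K \<noteq> {}" using gap[OF l2_space_zero] by auto
  then have N2: "2 \<le> N" using K(1) by (simp add: N_def Suc_leI card_gt_0_iff)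
  have qN: "q * N = N - 2 + 2 * r" using N by (simp add: q_def)
  have q: "0 \<le> q" "q < 1" using r N2 by (auto simp: q_def field_simps)
  have contraction: "l2_norm G (P f) \<le> q * l2_norm G f" if f: "f \<in> l2_space G" for f
  proof -
    obtain k where k: "k \<in> K" and far: "\<epsilon> * l2_norm G f \<le> l2_norm G (right_regular G k f - f)"
      using gap[OF f] by blast
    have R: "right_regular G k f \<in> l2_space G" "l2_norm G (right_regular G k f) = l2_norm G f"
      if "k \<in> K" for k using right_regular_l2[OF f] K(2) that by auto
    have "(l2_norm G (f + right_regular G k f))\<^sup>2
        = 4 * (l2_norm G f)\<^sup>2 - (l2_norm G (right_regular G k f - f))\<^sup>2"
      using l2_norm_parallelogram[OF f R(1)[OF k]] R(2)[OF k]
      by (simp add: l2_norm_minus_commute)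
    also have "\<dots> \<le> 4 * (l2_norm G f)\<^sup>2 - (\<epsilon> * l2_norm G f)\<^sup>2"
      using power_mono[OF far, of 2] K(3) by simp
    also have "\<dots> = (2 * l2_norm G f)\<^sup>2 * (1 - \<epsilon>\<^sup>2 / 4)" by (simp add: power2_eq_square algebra_simps)
    also have "\<dots> \<le> (2 * l2_norm G f)\<^sup>2 * r\<^sup>2" by (rule mult_left_mono[OF r_sq]) simp
    also have "\<dots> = (2 * r * l2_norm G f)\<^sup>2" by (simp add: power2_eq_square)
    finally have near: "l2_norm G (f + right_regular G k f) \<le> 2 * r * l2_norm G f"
      by (rule power2_le_imp_le) (simp add: r(1))
    have "(\<Sum>k\<in>K. right_regular G k f) = right_regular G k f + (\<Sum>k\<in>K - {k}. right_regular G k f)"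
      by (rule sum.remove[OF K(1) k])
    then have "l2_norm G (f + (\<Sum>k\<in>K. right_regular G k f))
        = l2_norm G ((f + right_regular G k f) + (\<Sum>k\<in>K - {k}. right_regular G k f))"
      by (simp only: add.assoc)
    also have "\<dots> \<le> l2_norm G (f + right_regular G k f) + l2_norm G (\<Sum>k\<in>K - {k}. right_regular G k f)"
      using R k by (intro l2_norm_triangle l2_space_add l2_space_sum f) auto
    also have "\<dots> \<le> 2 * r * l2_norm G f + (\<Sum>k\<in>K - {k}. l2_norm G (right_regular G k f))"
      using R by (intro add_mono near l2_norm_sum) auto
    also have "(\<Sum>k\<in>K - {k}. l2_norm G (right_regular G k f)) = (N - 2) * l2_norm G f"
      using R K(1) k N2 by (simp add: N_def card_Diff_singleton of_nat_diff Suc_leI card_gt_0_iff)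
    also have "2 * r * l2_norm G f + (N - 2) * l2_norm G f = q * N * l2_norm G f"
      unfolding qN by (simp add: distrib_right)
    finally have "l2_norm G (f + (\<Sum>k\<in>K. right_regular G k f)) \<le> q * N * l2_norm G f" .
    moreover have "y \<le> q * N * z \<Longrightarrow> cmod (c) * y \<le> q * z" for y z
      using N by (simp add: cN(1) pos_divide_le_eq mult_ac)
    ultimately show ?thesis unfolding P_apply[OF f] l2_norm_scale by blast
  qed
  define a where "a = (\<lambda>f x. c * neumann P f x)"
  have S: "neumann P \<in> group_vN G" by (rule neumann_mem[OF P q contraction])
  have a: "a \<in> group_vN G" unfolding a_def by (rule vN_scale_mem[OF S])
  show ?thesis
  proof
    show "a \<in> group_vN G" by fact
    fix h assume h: "h \<in> carrier G" and comm: "\<And>k. k \<in> K \<Longrightarrow> h \<otimes> k = k \<otimes> h"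
    note Rh = right_regular_mem[OF h]
    have "right_regular G k (right_regular G h f) = right_regular G h (right_regular G k f)"
      if "k \<in> K" for k f
      using right_regular_mult[OF h, of k] right_regular_mult[of k h] comm[OF that] h that K(2)
      by (metis comp_apply subsetD)
    then have swap: "(\<Sum>k\<in>K. right_regular G k (right_regular G h f))
        = (\<Sum>k\<in>K. right_regular G h (right_regular G k f))" for f by (rule sum.cong[OF refl])
    have "P (right_regular G h f) = right_regular G h (P f)" if f: "f \<in> l2_space G" for f
    proof -
      have R: "right_regular G k f \<in> l2_space G" if "k \<in> K" for k
        using right_regular_l2[OF f] K(2) that by auto
      have sum_l2: "(\<Sum>k\<in>K. right_regular G k f) \<in> l2_space G" by (rule l2_space_sum[OF R])
      have "right_regular G h (f + (\<Sum>k\<in>K. right_regular G k f))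
          = right_regular G h f + (\<Sum>k\<in>K. right_regular G k (right_regular G h f))"
      proof -
        have "right_regular G h (\<Sum>k\<in>K. right_regular G k f)
            = (\<Sum>k\<in>K. right_regular G h (right_regular G k f))" by (rule vN_sum[OF Rh R])
        then show ?thesis unfolding vN_add[OF Rh f sum_l2] swap by (rule arg_cong)
      qed
      then show ?thesis
        unfolding P_apply[OF f] P_apply[OF right_regular_l2(1)[OF f h]]
          vN_scale[OF Rh l2_space_add[OF f sum_l2]] by simp
    qed
    then have "neumann P (right_regular G h f) = right_regular G h (neumann P f)" if f: "f \<in> l2_space G" for f
      by (intro neumann_translate[OF P q contraction f, where \<tau> = "\<lambda>x. x \<otimes> h"])
         (auto simp: right_regular_l2 h, simp add: right_regular_def)
    then show "a \<circ> right_regular G h = right_regular G h \<circ> a"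
      by (intro right_regular_vN_commute[OF a h]) (simp add: a_def vN_scale[OF Rh] vN_l2[OF S])
  next
    fix T assume T: "T \<in> group_vN G"
    show "T = (\<Sum>k\<in>K. (T \<circ> a) - ((T \<circ> a) \<circ> right_regular G k))"
    proof
      fix f
      show "T f = (\<Sum>k\<in>K. (T \<circ> a) - ((T \<circ> a) \<circ> right_regular G k)) f"
      proof (cases "f \<in> l2_space G")
        case True
        have R: "right_regular G k f \<in> l2_space G" if "k \<in> K" for k
          using right_regular_l2[OF True] K(2) that by auto
        define s where "s = (\<Sum>k\<in>K. f - right_regular G k f)"
        have s: "s \<in> l2_space G" unfolding s_def by (intro l2_space_sum l2_space_diff True R)
        \<comment> \<open>The extra identity in \<open>P\<close> cancels one of the \<open>N\<close>
          copies of \<open>f\<close>, so \<open>1 - P\<close> is \<open>c\<close> times the sum of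
          the operators \<open>1 - right_regular G k\<close>.\<close>
        have eq: "f - P f = (\<lambda>x. c * s x)"
        proof
          fix x
          have "c * s x = c * (of_real N * f x) - c * (f x + (\<Sum>k\<in>K. right_regular G k f x))"
            by (simp add: s_def fun_sum_apply sum_subtractf N_def algebra_simps)
          also have "c * (of_real N * f x) = f x"
            using cN(2) by (metis mult.assoc mult.commute mult_1)
          finally show "(f - P f) x = c * s x"
            by (simp add: P_apply[OF True] fun_sum_apply)
        qed
        have "neumann P (\<lambda>x. c * s x) = f"
          using neumann_inverse[OF P q contraction True] by (simp only: eq)
        then have "a s = f" unfolding vN_scale[OF S s] by (simp only: a_def)
        moreover have "a s = (\<Sum>k\<in>K. a f - a (right_regular G k f))"
          unfolding s_def
          by (subst vN_sum[OF a]) (auto intro!: sum.cong l2_space_diff vN_diff[OF a] True R)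
        ultimately have "T f = T (\<Sum>k\<in>K. a f - a (right_regular G k f))" by simp
        also have "\<dots> = (\<Sum>k\<in>K. T (a f) - T (a (right_regular G k f)))"
          by (subst vN_sum[OF T]) (auto intro!: sum.cong l2_space_diff vN_diff[OF T] vN_l2[OF a] True R)
        finally have "T f = (\<Sum>k\<in>K. T (a f) - T (a (right_regular G k f)))" .
        then show ?thesis by (simp add: fun_sum_apply)
      next
        case False
        then have "right_regular G k f = 0" for k by (simp add: right_regular_def)
        with False show ?thesis by (simp add: vN_outside[OF T] vN_outside[OF a] vN_zero[OF a] fun_sum_apply)
      qed
    qed
  qed
qed

end

section \<open>Amenability from almost invariant vectors\<close>

text \<open>A compactness argument in the cube of [0,1]-valued set functions: additivity,
  normalization and invariance up to a tolerance are closed conditions. The bounds on all sets, not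
  only subsets of the carrier, place the approximate means in the cube.\<close>

lemma amenableI_approximate:
  fixes H :: "('g, 'b) monoid_scheme"
  assumes approx: "\<And>F \<epsilon>. finite F \<Longrightarrow> F \<subseteq> carrier H \<Longrightarrow> 0 < \<epsilon> \<Longrightarrow>
    \<exists>\<mu> :: 'g set \<Rightarrow> real. \<mu> (carrier H) = 1 \<and> (\<forall>A. 0 \<le> \<mu> A \<and> \<mu> A \<le> 1) \<and>
      (\<forall>A\<subseteq>carrier H. \<forall>B\<subseteq>carrier H. A \<inter> B = {} \<longrightarrow> \<mu> (A \<union> B) = \<mu> A + \<mu> B) \<and>
      (\<forall>g\<in>F. \<forall>A\<subseteq>carrier H. \<bar>\<mu> (g <#\<^bsub>H\<^esub> A) - \<mu> A\<bar> \<le> \<epsilon>)"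
  shows "amenable H"
proof -
  define cube :: "('g set \<Rightarrow> real) set" where "cube = PiE UNIV (\<lambda>_. {0..1})"
  define means where "means = {\<mu> :: 'g set \<Rightarrow> real. \<mu> (carrier H) = 1} \<inter>
    (\<Inter>A\<in>Pow (carrier H). \<Inter>B\<in>{B. B \<subseteq> carrier H \<and> A \<inter> B = {}}. {\<mu>. \<mu> (A \<union> B) = \<mu> A + \<mu> B})"
  define inv_up_to where "inv_up_to = (\<lambda>(g, n). \<Inter>A\<in>Pow (carrier H).
    {\<mu> :: 'g set \<Rightarrow> real. \<bar>\<mu> (g <#\<^bsub>H\<^esub> A) - \<mu> A\<bar> \<le> inverse (real (Suc n))})"
  have "compactin (product_topology (\<lambda>_. euclidean) UNIV) cube"
    unfolding cube_def by (simp add: compactin_PiE)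
  then have "compact cube" by (simp add: euclidean_product_topology)
  moreover have "closed means"
    unfolding means_def
    by (intro closed_Int closed_INT ballI closed_Collect_eq continuous_on_add
        continuous_on_product_coordinates continuous_on_const)
  ultimately have "compact (cube \<inter> means)" by (rule compact_Int_closed)
  moreover have "closed (inv_up_to i)" if "i \<in> carrier H \<times> UNIV" for i
    unfolding inv_up_to_def case_prod_unfold
    by (intro closed_INT ballI closed_Collect_le continuous_on_rabs continuous_on_diff
        continuous_on_product_coordinates continuous_on_const)
  moreover have "cube \<inter> means \<inter> (\<Inter>i\<in>I. inv_up_to i) \<noteq> {}"
    if I: "finite I" "I \<subseteq> carrier H \<times> UNIV" for I
  proof -
    \<comment> \<open>The largest index gives the smallest tolerance, which serves all conditions in
      the finite family.\<close>
    define n where "n = Max (insert 0 (snd ` I))"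
    have F: "finite (fst ` I)" "fst ` I \<subseteq> carrier H" using I by auto
    have "0 < inverse (real (Suc n))" by simp
    from approx[OF F this] obtain \<mu> :: "'g set \<Rightarrow> real" where \<mu>: "\<mu> (carrier H) = 1" "\<forall>A. 0 \<le> \<mu> A \<and> \<mu> A \<le> 1"
      "\<forall>A\<subseteq>carrier H. \<forall>B\<subseteq>carrier H. A \<inter> B = {} \<longrightarrow> \<mu> (A \<union> B) = \<mu> A + \<mu> B"
      "\<forall>g\<in>fst ` I. \<forall>A\<subseteq>carrier H. \<bar>\<mu> (g <#\<^bsub>H\<^esub> A) - \<mu> A\<bar> \<le> inverse (real (Suc n))"
      by (elim exE conjE) (rule that)
    have "\<mu> \<in> inv_up_to i" if "i \<in> I" for i
    proof -
      obtain g m where i: "i = (g, m)" by fastforce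
      have "m \<in> snd ` I" and g: "g \<in> fst ` I" using imageI[OF that] by (force simp: i)+
      then have "m \<le> n" using I(1) by (simp add: n_def)
      then have mn: "inverse (real (Suc n)) \<le> inverse (real (Suc m))" by simp
      have "\<bar>\<mu> (g <#\<^bsub>H\<^esub> A) - \<mu> A\<bar> \<le> inverse (real (Suc m))" if "A \<in> Pow (carrier H)" for A
        using \<mu>(4) g that mn by (meson PowD order_trans)
      then show ?thesis unfolding inv_up_to_def i by simp
    qed
    moreover have "\<mu> \<in> cube" using \<mu>(2) by (simp add: cube_def PiE_iff)
    moreover have "\<mu> \<in> means" using \<mu>(1,3) by (auto simp: means_def)
    ultimately show ?thesis by blast
  qed
  ultimately have "cube \<inter> means \<inter> (\<Inter>i\<in>carrier H \<times> UNIV. inv_up_to i) \<noteq> {}"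
    by (rule compact_imp_fip_image)
  then obtain \<mu> where \<mu>: "\<mu> \<in> cube" "\<mu> \<in> means" "\<And>g n. g \<in> carrier H \<Longrightarrow> \<mu> \<in> inv_up_to (g, n)"
    by blast
  have "\<mu> (g <#\<^bsub>H\<^esub> A) = \<mu> A" if "g \<in> carrier H" "A \<subseteq> carrier H" for g A
  proof -
    have "\<bar>\<mu> (g <#\<^bsub>H\<^esub> A) - \<mu> A\<bar> \<le> inverse (real (Suc n))" for n
      using \<mu>(3)[OF that(1), of n] that(2) by (auto simp: inv_up_to_def)
    then have "\<bar>\<mu> (g <#\<^bsub>H\<^esub> A) - \<mu> A\<bar> \<le> 0"
      by (intro LIMSEQ_le_const[OF LIMSEQ_inverse_real_of_nat]) auto
    then show ?thesis by simp
  qed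
  moreover have "0 \<le> \<mu> A" for A using \<mu>(1) by (auto simp: cube_def PiE_def Pi_def)
  moreover have "\<mu> (carrier H) = 1" using \<mu>(2) by (simp add: means_def)
  moreover have "\<mu> (A \<union> B) = \<mu> A + \<mu> B"
    if "A \<subseteq> carrier H" "B \<subseteq> carrier H" "A \<inter> B = {}" for A B
    using \<mu>(2) that unfolding means_def by blast
  ultimately show ?thesis
    unfolding amenable_def by (intro exI[of _ \<mu>] conjI allI ballI impI) blast+
qed

context group begin

text \<open>A representative \<open>r x\<close> depends only on the left coset of \<open>x\<close>,
  so \<open>inv (r x) \<otimes> x\<close> lies in \<open>H\<close> and is equivariant for right
  multiplication by \<open>H\<close>.\<close>

lemma coset_retraction:
  assumes H: "subgroup H G"
  obtains \<kappa> where "\<And>x. x \<in> carrier G \<Longrightarrow> \<kappa> x \<in> H"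
    and "\<And>x k. x \<in> carrier G \<Longrightarrow> k \<in> H \<Longrightarrow> \<kappa> (x \<otimes> k) = \<kappa> x \<otimes> k"
proof -
  interpret H: subgroup H G by fact
  define r where "r x = (SOME y. y \<in> x <# H)" for x
  have r: "r x \<in> x <# H" if "x \<in> carrier G" for x
  proof -
    have "x \<otimes> \<one> \<in> x <# H" using H.one_closed unfolding l_coset_def by blast
    then show ?thesis unfolding r_def by (rule someI)
  qed
  have r_carr: "r x \<in> carrier G" if "x \<in> carrier G" for x
    using r[OF that] that by (auto simp: l_coset_def)
  show ?thesis
  proof
    fix x assume x: "x \<in> carrier G"
    obtain h where h: "h \<in> H" "r x = x \<otimes> h" using r[OF x] by (auto simp: l_coset_def)
    have hc: "h \<in> carrier G" using h(1) by simp
    have "inv (r x) \<otimes> x = inv h"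
      unfolding h(2) using x hc by (simp add: inv_mult_group m_assoc)
    then show "inv (r x) \<otimes> x \<in> H" using h(1) by simp
    fix k assume k: "k \<in> H"
    have "x \<otimes> k \<in> x <# H" using k unfolding l_coset_def by blast
    then have "r (x \<otimes> k) = r x" using l_repr_independence[OF _ x H] by (simp add: r_def)
    then show "inv (r (x \<otimes> k)) \<otimes> (x \<otimes> k) = (inv (r x) \<otimes> x) \<otimes> k"
      using x k r_carr[OF x] by (simp add: m_assoc)
  qed
qed

text \<open>The squared modulus of an almost invariant unit vector is pushed forward to \<open>H\<close> along the
  equivariant map \<open>\<lambda>x. inv (\<kappa> x)\<close>.\<close>

theorem nonamenable_spectral_gap:
  assumes H: "subgroup H G" and nonamenable: "\<not> amenable (G\<lparr>carrier := H\<rparr>)"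
  obtains K \<epsilon> where "finite K" "K \<subseteq> H" "0 < \<epsilon>"
    "\<And>f. f \<in> l2_space G \<Longrightarrow> \<exists>k\<in>K. \<epsilon> * l2_norm G f \<le> l2_norm G (right_regular G k f - f)"
proof (rule ccontr)
  assume no_gap: "\<not> thesis"
  note gap_intro = that
  interpret H: subgroup H G by fact
  obtain \<kappa> where \<kappa>: "\<And>x. x \<in> carrier G \<Longrightarrow> \<kappa> x \<in> H"
    "\<And>x k. x \<in> carrier G \<Longrightarrow> k \<in> H \<Longrightarrow> \<kappa> (x \<otimes> k) = \<kappa> x \<otimes> k"
    using coset_retraction[OF H] by blast
  have almost_invariant: "\<exists>f\<in>l2_space G. l2_norm G f = 1 \<and>
      (\<forall>k\<in>K. l2_norm G (right_regular G k f - f) \<le> \<epsilon>)" if K: "finite K" "K \<subseteq> H" "0 < \<epsilon>" for K \<epsilon>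
  proof -
    \<comment> \<open>With \<open>\<one>\<close> inserted there is always a strict inequality to
      use, even for empty \<open>K\<close>, and it forces \<open>f\<close> to be nonzero.\<close>
    have "\<exists>f\<in>l2_space G. \<forall>k\<in>insert \<one> K. l2_norm G (right_regular G k f - f) < \<epsilon> * l2_norm G f"
    proof (rule ccontr)
      assume "\<not> (\<exists>f\<in>l2_space G. \<forall>k\<in>insert \<one> K. l2_norm G (right_regular G k f - f) < \<epsilon> * l2_norm G f)"
      then have "\<And>f. f \<in> l2_space G \<Longrightarrow>
          \<exists>k\<in>insert \<one> K. \<epsilon> * l2_norm G f \<le> l2_norm G (right_regular G k f - f)"
        by (meson not_less)
      then show False using no_gap gap_intro[of "insert \<one> K" \<epsilon>] K by auto
    qed
    then obtain f where f: "f \<in> l2_space G"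
      and near: "\<And>k. k \<in> insert \<one> K \<Longrightarrow> l2_norm G (right_regular G k f - f) < \<epsilon> * l2_norm G f"
      by blast
    have "0 < \<epsilon> * l2_norm G f" using near[of \<one>] l2_norm_nonneg by (meson insertI1 le_less_trans)
    then have pos: "0 < l2_norm G f" using K(3) by (simp add: zero_less_mult_iff)
    define c where "c = complex_of_real (1 / l2_norm G f)"
    have c: "cmod c = 1 / l2_norm G f" using pos by (simp add: c_def norm_divide)
    define h where "h = (\<lambda>x. c * f x)"
    have h: "h \<in> l2_space G" unfolding h_def by (rule l2_space_scale[OF f])
    have "l2_norm G h = 1" using pos unfolding h_def l2_norm_scale c by simp
    moreover have "l2_norm G (right_regular G k h - h) \<le> \<epsilon>" if k: "k \<in> K" for k
    proof -
      have "k \<in> carrier G" using k K(2) by auto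
      then have "right_regular G k h = (\<lambda>x. c * right_regular G k f x)"
        unfolding h_def by (rule vN_scale[OF right_regular_mem f])
      then have "right_regular G k h - h = (\<lambda>x. c * (right_regular G k f - f) x)"
        by (simp add: h_def fun_eq_iff right_diff_distrib)
      then have "l2_norm G (right_regular G k h - h) = l2_norm G (right_regular G k f - f) / l2_norm G f"
        by (simp only: l2_norm_scale c times_divide_eq_left mult_1)
      also have "\<dots> \<le> \<epsilon>" using near[of k] k pos by (simp add: pos_divide_le_eq)
      finally show ?thesis .
    qed
    ultimately show ?thesis using h by blast
  qed
  have "amenable (G\<lparr>carrier := H\<rparr>)"
  proof (rule amenableI_approximate)
    fix F and \<epsilon> :: real
    assume F: "finite F" "F \<subseteq> carrier (G\<lparr>carrier := H\<rparr>)" and \<epsilon>: "0 < \<epsilon>"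
    \<comment> \<open>Translating a subset of \<open>H\<close> by \<open>k\<close> corresponds to
      the regular action of \<open>inv k\<close>. Half the tolerance is taken because squares of
      norms at most 1 differ by at most twice the difference of the norms.\<close>
    obtain f where f: "f \<in> l2_space G" "l2_norm G f = 1"
      and near: "\<And>k. k \<in> (\<lambda>k. inv k) ` F \<Longrightarrow> l2_norm G (right_regular G k f - f) \<le> \<epsilon> / 2"
      using almost_invariant[of "(\<lambda>k. inv k) ` F" "\<epsilon> / 2"] F \<epsilon> by fastforce
    define res where "res A f = (\<lambda>x. if x \<in> carrier G \<and> inv (\<kappa> x) \<in> A then f x else 0)"
      for A and f :: "'a \<Rightarrow> complex"
    define \<mu> where "\<mu> A = (l2_norm G (res A f))\<^sup>2" for A
    have res: "res A f \<in> l2_space G" "l2_norm G (res A f) \<le> l2_norm G f" if "f \<in> l2_space G" for A f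
      by (rule l2_space_dominated[OF that]; simp add: res_def)+
    have inv_\<kappa>: "inv (\<kappa> x) \<in> H" if "x \<in> carrier G" for x using \<kappa>(1)[OF that] by simp
    have "\<mu> H = 1"
    proof -
      have "res H f = f" using inv_\<kappa> l2_space_outside[OF f(1)] by (auto simp: res_def fun_eq_iff)
      then show ?thesis by (simp add: \<mu>_def f)
    qed
    moreover have "0 \<le> \<mu> A \<and> \<mu> A \<le> 1" for A
      using res(2)[OF f(1), of A] f(2) by (simp add: \<mu>_def power_le_one)
    moreover have "\<mu> (A \<union> B) = \<mu> A + \<mu> B" if "A \<inter> B = {}" for A B
    proof -
      have "(cmod (res (A \<union> B) f x))\<^sup>2 = (cmod (res A f x))\<^sup>2 + (cmod (res B f x))\<^sup>2" for x
        using that by (auto simp: res_def)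
      then show ?thesis
        using res(1)[OF f(1), of A] res(1)[OF f(1), of B]
        by (simp add: \<mu>_def l2_norm_squared infsum_add l2_space_def)
    qed
    moreover have "\<bar>\<mu> (k <# A) - \<mu> A\<bar> \<le> \<epsilon>" if k: "k \<in> F" and A: "A \<subseteq> H" for k A
    proof -
      have kH: "k \<in> H" using F k by auto
      then have kc: "k \<in> carrier G" by simp
      define g where "g = right_regular G (inv k) f"
      have g: "g \<in> l2_space G" "l2_norm G g = 1" "l2_norm G (g - f) \<le> \<epsilon> / 2"
        using right_regular_l2[OF f(1), of "inv k"] near[of "inv k"] k kc f(2) by (auto simp: g_def)
      \<comment> \<open>Equivariance of \<open>\<kappa>\<close> gives \<open>inv (\<kappa> (x
        \<otimes> inv k)) = k \<otimes> inv (\<kappa> x)\<close>, so cutting off to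
        \<open>k <# A\<close> before translating is cutting off to \<open>A\<close>
        afterwards.\<close>
      have "res A g = right_regular G (inv k) (res (k <# A) f)"
      proof
        fix x
        show "res A g x = right_regular G (inv k) (res (k <# A) f) x"
        proof (cases "x \<in> carrier G")
          case True
          have \<kappa>x: "\<kappa> x \<in> carrier G" using \<kappa>(1)[OF True] by simp
          have "inv (\<kappa> (x \<otimes> inv k)) = k \<otimes> inv (\<kappa> x)"
            using \<kappa>(2)[OF True, of "inv k"] kH kc \<kappa>x by (simp add: inv_mult_group)
          moreover have "k \<otimes> inv (\<kappa> x) \<in> k <# A \<longleftrightarrow> inv (\<kappa> x) \<in> A"
          proof
            assume "k \<otimes> inv (\<kappa> x) \<in> k <# A"
            then obtain a where "a \<in> A" "k \<otimes> inv (\<kappa> x) = k \<otimes> a" by (auto simp: l_coset_def)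
            moreover have "a \<in> carrier G" using \<open>a \<in> A\<close> A by auto
            ultimately show "inv (\<kappa> x) \<in> A" using kc \<kappa>x by simp
          qed (auto simp: l_coset_def)
          moreover have "g x = f (x \<otimes> inv k)"
            unfolding g_def by (rule right_regular_apply[OF f(1) True])
          moreover have "right_regular G (inv k) (res (k <# A) f) x = res (k <# A) f (x \<otimes> inv k)"
            by (rule right_regular_apply[OF res(1)[OF f(1)] True])
          ultimately show ?thesis using True kc by (simp add: res_def)
        qed (simp add: res_def right_regular_def)
      qed
      then have "l2_norm G (res A g) = l2_norm G (res (k <# A) f)"
        using right_regular_l2(2)[OF res(1)[OF f(1)], of "inv k"] kc by simp
      moreover have "\<bar>l2_norm G (res A g) - l2_norm G (res A f)\<bar> \<le> \<epsilon> / 2"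
      proof -
        have "res A g - res A f = res A (g - f)" by (auto simp: res_def fun_eq_iff)
        then show ?thesis
          using l2_norm_triangle_diff[OF res(1)[OF g(1)] res(1)[OF f(1)]]
            res(2)[OF l2_space_diff[OF g(1) f(1)], of A] g(3) by (metis order_trans)
      qed
      moreover have "\<bar>a\<^sup>2 - b\<^sup>2\<bar> \<le> \<epsilon>" if "\<bar>a - b\<bar> \<le> \<epsilon> / 2" "0 \<le> a" "a \<le> 1" "0 \<le> b" "b \<le> 1" for a b :: real
      proof -
        have "\<bar>a\<^sup>2 - b\<^sup>2\<bar> = \<bar>a - b\<bar> * \<bar>a + b\<bar>"
          by (simp add: abs_mult[symmetric] power2_eq_square algebra_simps)
        also have "\<dots> \<le> (\<epsilon> / 2) * 2" using that \<epsilon> by (intro mult_mono) auto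
        finally show ?thesis by simp
      qed
      ultimately show ?thesis
        using res(2)[OF g(1), of A] res(2)[OF f(1), of A] g(2) f(2) by (simp add: \<mu>_def)
    qed
    moreover have "k <#\<^bsub>G\<lparr>carrier := H\<rparr>\<^esub> A = k <# A" for k A by (simp add: l_coset_def)
    ultimately show "\<exists>\<mu> :: 'a set \<Rightarrow> real. \<mu> (carrier (G\<lparr>carrier := H\<rparr>)) = 1 \<and> (\<forall>A. 0 \<le> \<mu> A \<and> \<mu> A \<le> 1) \<and>
      (\<forall>A\<subseteq>carrier (G\<lparr>carrier := H\<rparr>). \<forall>B\<subseteq>carrier (G\<lparr>carrier := H\<rparr>).
        A \<inter> B = {} \<longrightarrow> \<mu> (A \<union> B) = \<mu> A + \<mu> B) \<and>
      (\<forall>g\<in>F. \<forall>A\<subseteq>carrier (G\<lparr>carrier := H\<rparr>). \<bar>\<mu> (g <#\<^bsub>G\<lparr>carrier := H\<rparr>\<^esub> A) - \<mu> A\<bar> \<le> \<epsilon>)"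
      by (intro exI[of _ \<mu>]) simp
  qed
  with nonamenable show False ..
qed

end

section \<open>Rigid stabilizers in Hausdorff spaces\<close>

lemma (in group) amenable_singleton: "amenable (G\<lparr>carrier := {\<one>}\<rparr>)"
proof -
  have "\<one> <#\<^bsub>G\<lparr>carrier := {\<one>}\<rparr>\<^esub> A = A" if "A \<subseteq> {\<one>}" for A
    using subset_singletonD[OF that] by (auto simp: l_coset_def)
  then show ?thesis
    unfolding amenable_def by (intro exI[of _ "\<lambda>A. if \<one> \<in> A then 1 else 0"]) auto
qed

locale hausdorff_action = faithful_action G "topspace X" \<phi>
  for G (structure) and X :: "'x topology" and \<phi> +
  assumes hausdorff: "Hausdorff_space X"
    and homeo: "g \<in> carrier G \<Longrightarrow> homeomorphic_map X X (\<phi> g)"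
    and nonamenable: "openin X U \<Longrightarrow> U \<noteq> {} \<Longrightarrow>
           \<not> amenable (G\<lparr>carrier := rigid_stabilizer G (topspace X) \<phi> U\<rparr>)"
begin

sublocale group G
  using group_hom group_hom.axioms(1) by blast

abbreviation "RStab \<equiv> rigid_stabilizer G (topspace X) \<phi>"

lemma faithful_eqI:
  assumes "g \<in> carrier G" "h \<in> carrier G" "\<And>x. x \<in> topspace X \<Longrightarrow> \<phi> g x = \<phi> h x"
  shows "g = h"
proof -
  have "\<phi> g = \<phi> h"
    using bij_prop0[OF assms(1)] bij_prop0[OF assms(2)] assms(3)
    by (intro extensionalityI[of _ "topspace X"]) (auto simp: Bij_def)
  then show ?thesis using faithful assms by (simp add: inj_on_def)
qed

lemma act_closed: "g \<in> carrier G \<Longrightarrow> x \<in> topspace X \<Longrightarrow> \<phi> g x \<in> topspace X"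
  using element_image by blast

lemma act_one: "x \<in> topspace X \<Longrightarrow> \<phi> \<one> x = x"
  using id_eq_one by (metis restrict_apply')

lemma act_inv: "g \<in> carrier G \<Longrightarrow> x \<in> topspace X \<Longrightarrow> \<phi> (inv g) (\<phi> g x) = x"
  using orbit_sym_aux by blast

lemma act_inj: "g \<in> carrier G \<Longrightarrow> x \<in> topspace X \<Longrightarrow> y \<in> topspace X \<Longrightarrow> \<phi> g x = \<phi> g y \<Longrightarrow> x = y"
  by (metis act_inv)

text \<open>A point leaving \<open>V\<close> would have a fixed image, and injectivity would make
  the point itself fixed.\<close>

lemma rigid_stabilizer_preserves:
  assumes "k \<in> RStab V" "V \<subseteq> topspace X" "x \<in> V"
  shows "\<phi> k x \<in> V"
proof (rule ccontr)
  have k: "k \<in> carrier G" and fix_out: "\<And>y. y \<in> topspace X - V \<Longrightarrow> \<phi> k y = y"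
    using assms(1) by (auto simp: rigid_stabilizer_def)
  assume "\<phi> k x \<notin> V"
  then have "\<phi> k (\<phi> k x) = \<phi> k x" using assms k by (intro fix_out) (auto intro: act_closed)
  then have "\<phi> k x = x" using assms k act_inj act_closed by blast
  with \<open>\<phi> k x \<notin> V\<close> assms(3) show False by simp
qed

lemma subgroup_rigid_stabilizer: "subgroup (RStab V) G"
proof
  fix g h assume gh: "g \<in> RStab V" "h \<in> RStab V"
  then show "g \<otimes> h \<in> RStab V"
    by (auto simp: rigid_stabilizer_def composition_rule)
next
  fix g assume g: "g \<in> RStab V"
  then have "\<phi> (inv g) x = x" if "x \<in> topspace X - V" for x
    using that act_inv[of g x] by (auto simp: rigid_stabilizer_def)
  with g show "inv g \<in> RStab V" by (auto simp: rigid_stabilizer_def)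
qed (auto simp: rigid_stabilizer_def act_one)

text \<open>In a Hausdorff space a nonempty finite open set yields an open point; the rigid
  stabilizer of a point is trivial by faithfulness, hence amenable.\<close>

lemma open_not_subset_finite:
  assumes U: "openin X U" "U \<noteq> {}" and fin: "finite P"
  shows "\<not> U \<subseteq> P"
proof
  assume "U \<subseteq> P"
  then have finU: "finite U" using fin finite_subset by blast
  obtain y where y: "y \<in> U" using U(2) by blast
  have UX: "U \<subseteq> topspace X" using U(1) by (rule openin_subset)
  have "closedin X (U - {y})"
    using hausdorff finU UX by (intro closedin_Hausdorff_finite) auto
  then have "openin X (U - (U - {y}))" by (rule openin_diff[OF U(1)])
  moreover have "U - (U - {y}) = {y}" using y by blast
  ultimately have single: "openin X {y}" by simp
  have "RStab {y} = {\<one>}"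
  proof
    show "RStab {y} \<subseteq> {\<one>}"
    proof
      fix k assume k: "k \<in> RStab {y}"
      have "\<phi> k x = \<phi> \<one> x" if "x \<in> topspace X" for x
        using k that rigid_stabilizer_preserves[OF k, of y] UX y act_one[OF that]
        by (cases "x = y") (auto simp: rigid_stabilizer_def)
      then have "k = \<one>" using k by (intro faithful_eqI) (auto simp: rigid_stabilizer_def)
      then show "k \<in> {\<one>}" by simp
    qed
  qed (auto simp: rigid_stabilizer_def act_one)
  then show False using nonamenable[OF single] amenable_singleton by simp
qed

section \<open>Germs and centralizing rigid stabilizers\<close>

definition trivial_near :: "'x \<Rightarrow> 'a \<Rightarrow> bool" where
  "trivial_near x g \<longleftrightarrow> (\<exists>U. openin X U \<and> x \<in> U \<and> (\<forall>y\<in>U. \<phi> g y = y))"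

text \<open>Two group elements lie in the same left coset of this subgroup exactly when they agree
  near \<open>x\<close>, so its left cosets are the germs at \<open>x\<close>.\<close>

definition germ_stabilizer :: "'x \<Rightarrow> 'a set" where
  "germ_stabilizer x = {g \<in> carrier G. trivial_near x g}"

lemma subgroup_germ_stabilizer:
  assumes x: "x \<in> topspace X"
  shows "subgroup (germ_stabilizer x) G"
proof
  fix g h assume gh: "g \<in> germ_stabilizer x" "h \<in> germ_stabilizer x"
  then obtain U V where U: "openin X U" "x \<in> U" "\<forall>y\<in>U. \<phi> g y = y"
    and V: "openin X V" "x \<in> V" "\<forall>y\<in>V. \<phi> h y = y"
    by (auto simp: germ_stabilizer_def trivial_near_def)
  have "\<phi> (g \<otimes> h) y = y" if "y \<in> U \<inter> V" for y
  proof -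
    have "y \<in> topspace X" using that openin_subset[OF U(1)] by blast
    then show ?thesis using that U V gh by (simp add: composition_rule germ_stabilizer_def)
  qed
  moreover have "openin X (U \<inter> V)" using U V by blast
  ultimately show "g \<otimes> h \<in> germ_stabilizer x"
    using gh U(2) V(2) unfolding germ_stabilizer_def trivial_near_def by blast
next
  fix g assume g: "g \<in> germ_stabilizer x"
  then obtain U where U: "openin X U" "x \<in> U" "\<forall>y\<in>U. \<phi> g y = y" and gc: "g \<in> carrier G"
    by (auto simp: germ_stabilizer_def trivial_near_def)
  have "\<phi> (inv g) y = y" if "y \<in> U" for y
    using act_inv[OF gc, of y] that U openin_subset[OF U(1)] by auto
  then show "inv g \<in> germ_stabilizer x"
    using U gc unfolding germ_stabilizer_def trivial_near_def by blast
next
  have "\<forall>y\<in>topspace X. \<phi> \<one> y = y" using act_one by blast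
  then show "\<one> \<in> germ_stabilizer x"
    using x unfolding germ_stabilizer_def trivial_near_def by blast
qed (auto simp: germ_stabilizer_def)

text \<open>Elements of \<open>F\<close> are the identity on \<open>V\<close>, while elements of
  \<open>RStab V\<close> move points only within \<open>V\<close>, so they commute; an open set
  around \<open>P\<close> disjoint from \<open>V\<close> gives the last claim.\<close>

lemma centralizing_rigid_stabilizer:
  assumes x: "x \<in> topspace X" and F: "finite F" "F \<subseteq> germ_stabilizer x"
    and P: "finite P" "P \<subseteq> topspace X"
  obtains V where "openin X V" "V \<noteq> {}"
    and "\<And>f k. f \<in> F \<Longrightarrow> k \<in> RStab V \<Longrightarrow> f \<otimes> k = k \<otimes> f"
    and "\<And>p k. p \<in> P \<Longrightarrow> k \<in> RStab V \<Longrightarrow> trivial_near p k"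
proof -
  have "\<forall>f\<in>F. \<exists>U. openin X U \<and> x \<in> U \<and> (\<forall>y\<in>U. \<phi> f y = y)"
    using F by (auto simp: germ_stabilizer_def trivial_near_def)
  then obtain N where N: "\<And>f. f \<in> F \<Longrightarrow> openin X (N f) \<and> x \<in> N f \<and> (\<forall>y\<in>N f. \<phi> f y = y)"
    by metis
  \<comment> \<open>Intersecting with the whole space gives the right set also when \<open>F\<close>
    is empty.\<close>
  define U where "U = topspace X \<inter> (\<Inter>f\<in>F. N f)"
  have U: "openin X U" unfolding U_def
  proof (cases "F = {}")
    case False
    then show "openin X (topspace X \<inter> (\<Inter>f\<in>F. N f))"
      using N F(1) by (intro openin_Int openin_topspace openin_Inter) auto
  qed simp
  have "U \<noteq> {}" using N x by (auto simp: U_def)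
  then obtain y where y: "y \<in> U" "y \<notin> P" using open_not_subset_finite[OF U _ P(1)] by blast
  have "compactin X {y}" "compactin X P" "disjnt {y} P"
    using y P by (auto simp: U_def finite_imp_compactin)
  then obtain V0 W where VW: "openin X V0" "openin X W" "{y} \<subseteq> V0" "P \<subseteq> W" "disjnt V0 W"
    using Hausdorff_space_compact_separation[OF hausdorff] by metis
  define V where "V = V0 \<inter> U"
  have V: "openin X V" "V \<noteq> {}" "V \<subseteq> U" "V \<subseteq> topspace X" "V \<inter> W = {}"
    using VW U y by (auto simp: V_def U_def disjnt_def)
  show ?thesis
  proof
    show "openin X V" "V \<noteq> {}" by fact+
    fix k assume k: "k \<in> RStab V"
    have kc: "k \<in> carrier G" and k_out: "\<And>z. z \<in> topspace X - V \<Longrightarrow> \<phi> k z = z"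
      using k by (auto simp: rigid_stabilizer_def)
    have "\<forall>z\<in>W. \<phi> k z = z" using k_out V(5) openin_subset[OF VW(2)] by blast
    then show "trivial_near p k" if "p \<in> P" for p
      using that VW(2,4) unfolding trivial_near_def by blast
    fix f assume f: "f \<in> F"
    have fc: "f \<in> carrier G" using F f by (auto simp: germ_stabilizer_def)
    have f_in: "\<phi> f z = z" if "z \<in> V" for z using N[OF f] that V(3) f by (auto simp: U_def)
    show "f \<otimes> k = k \<otimes> f"
    proof (rule faithful_eqI)
      fix z assume z: "z \<in> topspace X"
      have "\<phi> f (\<phi> k z) = \<phi> k (\<phi> f z)"
      proof (cases "z \<in> V")
        case True
        then show ?thesis using f_in rigid_stabilizer_preserves[OF k V(4)] by simp
      next
        case False
        have "\<phi> f z \<notin> V"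
        proof
          assume "\<phi> f z \<in> V"
          then have "\<phi> f (\<phi> f z) = \<phi> f z" by (rule f_in)
          then have "\<phi> f z = z" using act_inj[OF fc act_closed[OF fc z] z] by blast
          with False \<open>\<phi> f z \<in> V\<close> show False by simp
        qed
        then show ?thesis using False z k_out act_closed[OF fc z] by simp
      qed
      then show "\<phi> (f \<otimes> k) z = \<phi> (k \<otimes> f) z" using z fc kc by (simp add: composition_rule)
    qed (use fc kc in auto)
  qed
qed

text \<open>Continuity pulls the neighbourhood of \<open>\<phi> h x\<close> back to
  \<open>x\<close>. In terms of cosets, \<open>k\<close> fixes the germ of \<open>h\<close> at
  \<open>x\<close>.\<close>

lemma trivial_near_conj:
  assumes x: "x \<in> topspace X" and h: "h \<in> carrier G" and k: "k \<in> carrier G"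
    and near: "trivial_near (\<phi> h x) k"
  shows "inv h \<otimes> k \<otimes> h \<in> germ_stabilizer x"
proof -
  obtain W where W: "openin X W" "\<phi> h x \<in> W" "\<forall>y\<in>W. \<phi> k y = y"
    using near by (auto simp: trivial_near_def)
  have "continuous_map X X (\<phi> h)" using homeo[OF h] by (rule homeomorphic_imp_continuous_map)
  then have "openin X {y \<in> topspace X. \<phi> h y \<in> W}"
    using W(1) by (rule openin_continuous_map_preimage)
  moreover have "\<phi> (inv h \<otimes> k \<otimes> h) y = y" if "y \<in> topspace X" "\<phi> h y \<in> W" for y
    using that W(3) h k by (simp add: composition_rule act_closed act_inv)
  ultimately have "trivial_near x (inv h \<otimes> k \<otimes> h)"
    using x W(2) unfolding trivial_near_def by blast
  then show ?thesis using h k by (simp add: germ_stabilizer_def)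
qed

section \<open>Verification of the splitting for germs\<close>

theorem l2_invisible:
  assumes "topspace X \<noteq> {}"
  shows "l2_invisible G"
proof -
  obtain x where x: "x \<in> topspace X" using assms by blast
  define D where "D = germ_stabilizer x"
  have D: "subgroup D G" unfolding D_def by (rule subgroup_germ_stabilizer[OF x])
  have D_sub: "D \<subseteq> carrier G" using subgroup.subset[OF D] .
  define S where "S = (\<lambda>g. g <# D) ` carrier G"
  define lift_germ where "lift_germ C = (SOME g. g \<in> carrier G \<and> g <# D = C)" for C
  have lift: "lift_germ C \<in> carrier G" "lift_germ C <# D = C" if "C \<in> S" for C
  proof -
    have "\<exists>g. g \<in> carrier G \<and> g <# D = C" using that by (auto simp: S_def)
    then have "lift_germ C \<in> carrier G \<and> lift_germ C <# D = C" unfolding lift_germ_def by (rule someI_ex)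
    then show "lift_germ C \<in> carrier G" "lift_germ C <# D = C" by auto
  qed
  have S_sub: "C \<subseteq> carrier G" if "C \<in> S" for C
    using that D_sub by (auto simp: S_def l_coset_def)
  interpret germ_split G "group_vN G" "vN_act G" S "l_coset G" D lift_germ
  proof unfold_locales
    show "add_subgroup (group_vN G)"
      unfolding add_subgroup_def
      using vN_zero_mem vN_add_mem vN_uminus_mem by (metis diff_conv_add_uminus)
    show "vN_act G (T + U) g = vN_act G T g + vN_act G U g" for T U g
      by (simp add: vN_act_def fun_eq_iff)
    show "vN_act G T g \<in> group_vN G" if "T \<in> group_vN G" "g \<in> carrier G" for T g
      unfolding vN_act_def by (intro vN_comp_mem right_regular_mem that)
    show "vN_act G T (g \<otimes> h) = vN_act G (vN_act G T g) h" if "g \<in> carrier G" "h \<in> carrier G" for T g h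
      by (simp add: vN_act_def right_regular_mult[OF that] comp_assoc)
    show "vN_act G T \<one> = T" if T: "T \<in> group_vN G" for T
    proof
      fix f
      have "f \<notin> l2_space G \<Longrightarrow> right_regular G \<one> f = 0" by (simp add: right_regular_def)
      then show "vN_act G T \<one> f = T f"
        by (cases "f \<in> l2_space G")
           (simp_all add: vN_act_def right_regular_one vN_outside[OF T] vN_zero[OF T])
    qed
    have "\<one> <# D = D" using D_sub by (rule lcos_mult_one)
    then show "D \<in> S" unfolding S_def by (metis imageI one_closed)
    show "g <# C \<in> S" if "g \<in> carrier G" "C \<in> S" for g C
      using that lcos_m_assoc[OF D_sub] by (fastforce simp: S_def)
    show "(g \<otimes> h) <# C = g <# (h <# C)" if "g \<in> carrier G" "h \<in> carrier G" "C \<in> S" for g h C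
      using lcos_m_assoc[OF S_sub] that by simp
    show "\<one> <# C = C" if "C \<in> S" for C using lcos_mult_one[OF S_sub[OF that]] .
    show "lift_germ C \<in> carrier G" "lift_germ C <# D = C" if "C \<in> S" for C
      using lift[OF that] by auto
    fix F Q assume F: "finite F" "F \<subseteq> {g \<in> carrier G. g <# D = D}" and Q: "finite Q" "Q \<subseteq> S"
    have FD: "F \<subseteq> germ_stabilizer x"
    proof
      fix f assume "f \<in> F"
      then have f: "f \<in> carrier G" "f <# D = D" using F by auto
      have "f \<otimes> \<one> \<in> f <# D" using subgroup.one_closed[OF D] unfolding l_coset_def by blast
      then show "f \<in> germ_stabilizer x" using f by (simp add: D_def)
    qed
    \<comment> \<open>Near these points \<open>k\<close> must be trivial in order to fix every germ
      in \<open>Q\<close>.\<close>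
    define P where "P = (\<lambda>C. \<phi> (lift_germ C) x) ` Q"
    have P: "finite P" "P \<subseteq> topspace X"
      using Q lift(1) x by (auto simp: P_def intro!: act_closed)
    obtain V where V: "openin X V" "V \<noteq> {}"
      and comm: "\<And>f k. f \<in> F \<Longrightarrow> k \<in> RStab V \<Longrightarrow> f \<otimes> k = k \<otimes> f"
      and near: "\<And>p k. p \<in> P \<Longrightarrow> k \<in> RStab V \<Longrightarrow> trivial_near p k"
      using centralizing_rigid_stabilizer[OF x F(1) FD P] by blast
    obtain K \<epsilon> where K: "finite K" "K \<subseteq> RStab V" "0 < \<epsilon>"
      and gap: "\<And>f. f \<in> l2_space G \<Longrightarrow> \<exists>k\<in>K. \<epsilon> * l2_norm G f \<le> l2_norm G (right_regular G k f - f)"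
      using nonamenable_spectral_gap[OF subgroup_rigid_stabilizer nonamenable[OF V]] by metis
    have K_carr: "K \<subseteq> carrier G" using K(2) by (auto simp: rigid_stabilizer_def)
    obtain a where a: "a \<in> group_vN G"
      and a_comm: "\<And>h. h \<in> carrier G \<Longrightarrow> (\<And>k. k \<in> K \<Longrightarrow> h \<otimes> k = k \<otimes> h) \<Longrightarrow>
           a \<circ> right_regular G h = right_regular G h \<circ> a"
      and a_split: "\<And>T. T \<in> group_vN G \<Longrightarrow> T = (\<Sum>k\<in>K. (T \<circ> a) - ((T \<circ> a) \<circ> right_regular G k))"
      using spectral_gap_splitting[OF K(1) K_carr K(3) gap] by metis
    show "\<exists>A K. Modules.additive A \<and> A ` group_vN G \<subseteq> group_vN G \<and> finite K \<and> K \<subseteq> carrier G \<and>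
        (\<forall>f\<in>F. \<forall>m\<in>group_vN G. A (vN_act G m f) = vN_act G (A m) f) \<and>
        (\<forall>f\<in>F. \<forall>k\<in>K. f \<otimes> k = k \<otimes> f) \<and> (\<forall>k\<in>K. \<forall>s\<in>Q. k <# s = s) \<and>
        (\<forall>m\<in>group_vN G. m = (\<Sum>k\<in>K. A m - vN_act G (A m) k))"
    proof (intro exI[of _ "\<lambda>T. T \<circ> a"] exI[of _ K] conjI ballI)
      show "Modules.additive (\<lambda>T. T \<circ> a)" by (simp add: Modules.additive_def fun_eq_iff)
      show "(\<lambda>T. T \<circ> a) ` group_vN G \<subseteq> group_vN G" using vN_comp_mem a by blast
      show "finite K" "K \<subseteq> carrier G" by fact+
      show "f \<otimes> k = k \<otimes> f" if "f \<in> F" "k \<in> K" for f k using comm that K(2) by blast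
      then show "vN_act G T f \<circ> a = vN_act G (T \<circ> a) f" if "f \<in> F" for f T
        using a_comm[of f] that F(2) by (auto simp: vN_act_def comp_assoc)
      show "T = (\<Sum>k\<in>K. (T \<circ> a) - vN_act G (T \<circ> a) k)" if "T \<in> group_vN G" for T
        using a_split[OF that] by (simp only: vN_act_def)
      fix k C assume k: "k \<in> K" and C: "C \<in> Q"
      define h where "h = lift_germ C"
      have CS: "C \<in> S" using C Q by blast
      have h: "h \<in> carrier G" "h <# D = C" using lift[OF CS] by (simp_all add: h_def)
      have kc: "k \<in> carrier G" using k K_carr by blast
      have "\<phi> h x \<in> P" using C by (simp add: P_def h_def)
      then have d: "inv h \<otimes> k \<otimes> h \<in> D"
        unfolding D_def using near k K(2) by (intro trivial_near_conj x h(1) kc) auto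
      then have dc: "inv h \<otimes> k \<otimes> h \<in> carrier G" using D_sub by blast
      \<comment> \<open>Writing \<open>k \<otimes> h\<close> as \<open>h\<close> times an element of
        \<open>D\<close> shows that \<open>k\<close> fixes the coset of \<open>h\<close>.\<close>
      have "k <# C = (k \<otimes> h) <# D" using lcos_m_assoc[OF D_sub kc h(1)] h(2) by simp
      also have "k \<otimes> h = h \<otimes> (inv h \<otimes> k \<otimes> h)" using h(1) kc by (simp add: m_assoc[symmetric])
      also have "\<dots> <# D = h <# ((inv h \<otimes> k \<otimes> h) <# D)" using lcos_m_assoc[OF D_sub h(1) dc] by simp
      also have "(inv h \<otimes> k \<otimes> h) <# D = D" using coset_join3[OF dc D d] .
      finally show "k <# C = C" using h(2) by simp
    qed
  qed
  show ?thesis unfolding l2_invisible_def using group_homology_trivial by blast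
qed

end

theorem theoremD:
  fixes G (structure) and X :: "'x topology" and \<phi> :: "'g \<Rightarrow> 'x \<Rightarrow> 'x"
  assumes "Hausdorff_space X"
    and "topspace X \<noteq> {}"
    and "faithful_action G (topspace X) \<phi>"
    and "\<And>g. g \<in> carrier G \<Longrightarrow> homeomorphic_map X X (\<phi> g)"
    and "\<And>U. openin X U \<Longrightarrow> U \<noteq> {} \<Longrightarrow>
           \<not> amenable (G\<lparr>carrier := rigid_stabilizer G (topspace X) \<phi> U\<rparr>)"
  shows "l2_invisible G"
proof -
  interpret faithful_action G "topspace X" \<phi> by fact
  interpret hausdorff_action G X \<phi>
    by unfold_locales (use assms in auto)
  show ?thesis by (rule l2_invisible) fact
qed

end
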